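(* There is a constant $C>0$ such that for every formula $f$ on $n$ input variables with formula size $S$ and $G$ gates, $Q(f)\le C\min\{n,\sqrt{S},n^{1/2}G^{1/4}\}$.
   Context: A formula on input variables $x_1,\dots,x_n$ is a rooted tree whose leaves are labeled by input variables (the same variable may label many leaves) and whose internal vertices are \textsc{not} gates (fanin 1) or unbounded-fanin \textsc{and}/\textsc{or} gates. The size $S$ of a formula is the number of leaves (inputs counted with multiplicity); the gate count $G$ is the number of \textsc{and} and \textsc{or} gates (\textsc{not} gates not counted). For a Boolean function $f$ on $n$ bits, $Q(f)$ denotes its bounded-error quantum query complexity: the minimum number of queries to the oracle $|i,b\rangle\mapsto|i,b\oplus x_i\rangle$ made by a quantum algorithm that outputs $f(x)$ with probability at least $2/3$ for every input $x$.
   Formalization: The formula is assumed to have at least one AND/OR gate (G ≥ 1): for G = 0 the formula is a literal such as x_1, where the bound n^{1/2}G^{1/4} is 0 but Q(f) = 1, so the claim fails there. *)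

theory Defs
  imports Complex_Main
begin

datatype formula = Var nat | Neg formula | AndG "formula list" | OrG "formula list"

fun eval :: "(nat \<Rightarrow> bool) \<Rightarrow> formula \<Rightarrow> bool" where
  "eval x (Var i) = x i"
| "eval x (Neg f) = (\<not> eval x f)"
| "eval x (AndG fs) = (\<forall>g\<in>set fs. eval x g)"
| "eval x (OrG fs) = (\<exists>g\<in>set fs. eval x g)"

fun wf_formula :: "nat \<Rightarrow> formula \<Rightarrow> bool" where
  "wf_formula n (Var i) = (i < n)"
| "wf_formula n (Neg f) = wf_formula n f"
| "wf_formula n (AndG fs) = (fs \<noteq> [] \<and> (\<forall>g\<in>set fs. wf_formula n g))"
| "wf_formula n (OrG fs) = (fs \<noteq> [] \<and> (\<forall>g\<in>set fs. wf_formula n g))"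

fun leaves :: "formula \<Rightarrow> nat" where
  "leaves (Var i) = 1"
| "leaves (Neg f) = leaves f"
| "leaves (AndG fs) = sum_list (map leaves fs)"
| "leaves (OrG fs) = sum_list (map leaves fs)"

fun gates :: "formula \<Rightarrow> nat" where
  "gates (Var i) = 0"
| "gates (Neg f) = gates f"
| "gates (AndG fs) = 1 + sum_list (map gates fs)"
| "gates (OrG fs) = 1 + sum_list (map gates fs)"

text \<open>Hilbert space of dimension D = 2*n*m with computational basis indexed by k < D,
  encoding the triple (i, b, w) = (k mod n, (k div n) mod 2, k div (2n)):
  query index i < n, query_op bit b, workspace w < m.
  States are functions nat => complex (zero outside {0..<D});
  matrices are functions nat => nat => complex (only entries below D matter).\<close>

definition apply_mat :: "nat \<Rightarrow> (nat \<Rightarrow> nat \<Rightarrow> complex) \<Rightarrow> (nat \<Rightarrow> complex) \<Rightarrow> nat \<Rightarrow> complex" where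
  "apply_mat D U v = (\<lambda>k. if k < D then (\<Sum>j<D. U k j * v j) else 0)"

definition unitary_mat :: "nat \<Rightarrow> (nat \<Rightarrow> nat \<Rightarrow> complex) \<Rightarrow> bool" where
  "unitary_mat D U \<longleftrightarrow>
     (\<forall>j<D. \<forall>k<D. (\<Sum>i<D. cnj (U i j) * U i k) = (if j = k then 1 else 0))"

text \<open>The query query |i,b,w> |-> |i, b xor x_i, w> as a permutation of basis indices.\<close>
definition qop_idx :: "nat \<Rightarrow> (nat \<Rightarrow> bool) \<Rightarrow> nat \<Rightarrow> nat" where
  "qop_idx n x k =
     (if x (k mod n) then (if (k div n) mod 2 = 0 then k + n else k - n) else k)"

definition query_op :: "nat \<Rightarrow> nat \<Rightarrow> (nat \<Rightarrow> bool) \<Rightarrow> (nat \<Rightarrow> complex) \<Rightarrow> nat \<Rightarrow> complex" where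
  "query_op D n x v = (\<lambda>k. if k < D then v (qop_idx n x k) else 0)"

fun qrun :: "nat \<Rightarrow> nat \<Rightarrow> (nat \<Rightarrow> bool) \<Rightarrow> (nat \<Rightarrow> nat \<Rightarrow> complex) list
              \<Rightarrow> (nat \<Rightarrow> complex) \<Rightarrow> nat \<Rightarrow> complex" where
  "qrun D n x [] v = v"
| "qrun D n x (U # Us) v = qrun D n x Us (apply_mat D U (query_op D n x v))"

definition init_state :: "nat \<Rightarrow> complex" where
  "init_state = (\<lambda>k. if k = 0 then 1 else 0)"

definition final_state ::
  "nat \<Rightarrow> nat \<Rightarrow> (nat \<Rightarrow> bool) \<Rightarrow> (nat \<Rightarrow> nat \<Rightarrow> complex) \<Rightarrow> (nat \<Rightarrow> nat \<Rightarrow> complex) list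
   \<Rightarrow> nat \<Rightarrow> complex" where
  "final_state D n x U0 Us = qrun D n x Us (apply_mat D U0 init_state)"

definition out_prob ::
  "nat \<Rightarrow> nat \<Rightarrow> (nat \<Rightarrow> bool) \<Rightarrow> (nat \<Rightarrow> nat \<Rightarrow> complex) \<Rightarrow> (nat \<Rightarrow> nat \<Rightarrow> complex) list
   \<Rightarrow> (nat \<Rightarrow> bool) \<Rightarrow> bool \<Rightarrow> real" where
  "out_prob D n x U0 Us out c = (\<Sum>k\<in>{k. k < D \<and> out k = c}. (cmod (final_state D n x U0 Us k))\<^sup>2)"

definition computes_with_queries :: "nat \<Rightarrow> ((nat \<Rightarrow> bool) \<Rightarrow> bool) \<Rightarrow> nat \<Rightarrow> bool" where
  "computes_with_queries n f T \<longleftrightarrow>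
     (\<exists>m::nat. m \<ge> 1 \<and>
       (\<exists>U0 Us out. length Us = T \<and>
          unitary_mat (2 * n * m) U0 \<and> (\<forall>U\<in>set Us. unitary_mat (2 * n * m) U) \<and>
          (\<forall>x. out_prob (2 * n * m) n x U0 Us out (f x) \<ge> 2 / 3)))"

text \<open>Bounded-error quantum query complexity Q(f) of a function on n bits
  (the function is given on nat => bool and is only ever applied to the bits below n).\<close>
definition Q :: "nat \<Rightarrow> ((nat \<Rightarrow> bool) \<Rightarrow> bool) \<Rightarrow> nat" where
  "Q n f = (LEAST T. computes_with_queries n f T)"

end

theory Submission
  imports Defs
begin

text \<open>
  The proof goes through the dual of the adversary bound. A Boolean function \<open>f\<close> has a witness of
  size \<open>W\<close> if there are vectors \<open>u x j\<close> with \<open>\<Sum>j. |u x j|^2 \<le> W\<close> such that the inner products of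
  \<open>u x j\<close> and \<open>u y j\<close>, summed over the \<open>j\<close> with \<open>x j \<noteq> y j\<close>, give 1 whenever \<open>f x\<close> and \<open>\<not> f y\<close>.

  Witnesses compose: conjunctions and disjunctions add squared sizes, which gives \<open>sqrt S\<close>; and a
  decision tree that guesses each answer pays \<open>\<alpha>\<close> for a right guess and \<open>1 / \<alpha>\<close> for a wrong one.
  Querying variables that may kill at least \<open>sqrt G\<close> gates, and guessing that they do not, leads to at
  most \<open>n\<close> right and \<open>sqrt G\<close> wrong guesses, and ends with a formula of size at most
  \<open>2 * n * sqrt G\<close>. This gives \<open>n^(1/2) * G^(1/4)\<close>.

  A witness of size \<open>W\<close> yields an algorithm with \<open>O(W)\<close> queries. Let \<open>U\<close> be the product of the input
  reflection and the reflection that negates the vectors \<open>q y\<close> with \<open>\<not> f y\<close>. If \<open>f x\<close>, then the start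
  state is close to a fixed vector of \<open>U\<close>; otherwise twice the start state is \<open>q' - U q'\<close> for some
  \<open>q'\<close> of norm \<open>O(W)\<close>, so that the average of its first \<open>T\<close> iterates telescopes and is small for
  \<open>T\<close> of order \<open>W\<close>.
\<close>

subsection \<open>Witnesses for the dual adversary bound\<close>

text \<open>The whole kernel \<open>g\<close> and the exact squared norms \<open>s\<close> are
  recorded, not only bounds, so that sums and input-dependent rescalings can be tracked. Zero
  entries from \<open>d\<close> on allow padding to a common dimension.\<close>

definition kernel_rep ::
  "nat \<Rightarrow> ((nat \<Rightarrow> bool) \<Rightarrow> (nat \<Rightarrow> bool) \<Rightarrow> real) \<Rightarrow> ((nat \<Rightarrow> bool) \<Rightarrow> real) \<Rightarrow> bool" where
  "kernel_rep n g s \<longleftrightarrow> (\<exists>(d::nat) (u :: (nat \<Rightarrow> bool) \<Rightarrow> nat \<Rightarrow> nat \<Rightarrow> real).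
     (\<forall>x j a. a \<ge> d \<longrightarrow> u x j a = 0) \<and>
     (\<forall>x. (\<Sum>j<n. \<Sum>a<d. (u x j a)\<^sup>2) = s x) \<and>
     (\<forall>x y. (\<Sum>j<n. if x j \<noteq> y j then \<Sum>a<d. u x j a * u y j a else 0) = g x y))"

lemma kernel_repE:
  assumes "kernel_rep n g s"
  obtains d :: nat and u where "\<And>x j a. a \<ge> d \<Longrightarrow> u x j a = 0"
    "\<And>x. (\<Sum>j<n. \<Sum>a<d. (u x j a)\<^sup>2) = s x"
    "\<And>x y. (\<Sum>j<n. if x j \<noteq> y j then \<Sum>a<d. u x j a * u y j a else 0) = g x y"
  using assms unfolding kernel_rep_def by blast

lemma sum_double:
  fixes f :: "nat \<Rightarrow> 'a::comm_monoid_add"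
  shows "(\<Sum>a<2*d. f a) = (\<Sum>a<d. f (2*a)) + (\<Sum>a<d. f (2*a+1))"
  by (induction d) (auto simp: algebra_simps)

text \<open>Direct sum of the two families of vectors, interleaved on even and odd indices.\<close>

lemma kernel_rep_add:
  assumes "kernel_rep n g1 s1" "kernel_rep n g2 s2"
  shows "kernel_rep n (\<lambda>x y. g1 x y + g2 x y) (\<lambda>x. s1 x + s2 x)"
proof -
  obtain d1 :: nat and u1 where 1: "\<And>x j a. a \<ge> d1 \<Longrightarrow> u1 x j a = 0"
    "\<And>x. (\<Sum>j<n. \<Sum>a<d1. (u1 x j a)\<^sup>2) = s1 x"
    "\<And>x y. (\<Sum>j<n. if x j \<noteq> y j then \<Sum>a<d1. u1 x j a * u1 y j a else 0) = g1 x y"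
    by (rule kernel_repE[OF assms(1)]) blast
  obtain d2 :: nat and u2 where 2: "\<And>x j a. a \<ge> d2 \<Longrightarrow> u2 x j a = 0"
    "\<And>x. (\<Sum>j<n. \<Sum>a<d2. (u2 x j a)\<^sup>2) = s2 x"
    "\<And>x y. (\<Sum>j<n. if x j \<noteq> y j then \<Sum>a<d2. u2 x j a * u2 y j a else 0) = g2 x y"
    by (rule kernel_repE[OF assms(2)]) blast
  define d where "d = max d1 d2"
  define u where "u x j a = (if even a then u1 x j (a div 2) else u2 x j (a div 2))" for x j a
  have pad1: "(\<Sum>a<d. u1 x j a * u1 y j a) = (\<Sum>a<d1. u1 x j a * u1 y j a)" for x y j
    by (rule sum.mono_neutral_right) (auto simp: d_def 1)
  have pad2: "(\<Sum>a<d. u2 x j a * u2 y j a) = (\<Sum>a<d2. u2 x j a * u2 y j a)" for x y j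
    by (rule sum.mono_neutral_right) (auto simp: d_def 2)
  have inner: "(\<Sum>a<2*d. u x j a * u y j a)
      = (\<Sum>a<d1. u1 x j a * u1 y j a) + (\<Sum>a<d2. u2 x j a * u2 y j a)" for x y j
    unfolding sum_double by (simp add: u_def pad1 pad2)
  show ?thesis
    unfolding kernel_rep_def
  proof (intro exI[of _ "2*d"] exI[of _ u] conjI allI impI)
    fix x j and a :: nat assume "2*d \<le> a"
    then have "d1 \<le> a div 2" "d2 \<le> a div 2" by (auto simp: d_def)
    then show "u x j a = 0" by (simp add: u_def 1 2)
  next
    fix x show "(\<Sum>j<n. \<Sum>a<2*d. (u x j a)\<^sup>2) = s1 x + s2 x"
      using 1(2)[of x] 2(2)[of x] by (simp add: power2_eq_square inner sum.distrib)
  next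
    fix x y show "(\<Sum>j<n. if x j \<noteq> y j then \<Sum>a<2*d. u x j a * u y j a else 0) = g1 x y + g2 x y"
      unfolding 1(3)[symmetric] 2(3)[symmetric] sum.distrib[symmetric] inner
      by (rule sum.cong) auto
  qed
qed

text \<open>The vectors of \<open>x\<close> are multiplied by \<open>c x\<close>. As the factor
  depends on the input, a witness can be reweighted or switched off input by input.\<close>

lemma kernel_rep_scale:
  assumes "kernel_rep n g s"
  shows "kernel_rep n (\<lambda>x y. c x * c y * g x y) (\<lambda>x. (c x)\<^sup>2 * s x)"
proof -
  obtain d :: nat and u where 1: "\<And>x j a. a \<ge> d \<Longrightarrow> u x j a = 0"
    "\<And>x. (\<Sum>j<n. \<Sum>a<d. (u x j a)\<^sup>2) = s x"
    "\<And>x y. (\<Sum>j<n. if x j \<noteq> y j then \<Sum>a<d. u x j a * u y j a else 0) = g x y"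
    by (rule kernel_repE[OF assms(1)]) blast
  show ?thesis
    unfolding kernel_rep_def
  proof (intro exI[of _ d] exI[of _ "\<lambda>x j a. c x * u x j a"] conjI allI impI)
    fix x y
    show "(\<Sum>j<n. if x j \<noteq> y j then \<Sum>a<d. c x * u x j a * (c y * u y j a) else 0) = c x * c y * g x y"
      unfolding 1(3)[symmetric] sum_distrib_left
      by (rule sum.cong) (auto simp: sum_distrib_left intro!: sum.cong)
  next
    fix x show "(\<Sum>j<n. \<Sum>a<d. (c x * u x j a)\<^sup>2) = (c x)\<^sup>2 * s x"
      unfolding 1(2)[symmetric] by (simp add: power_mult_distrib sum_distrib_left)
  qed (simp add: 1)
qed

lemma kernel_rep_var:
  assumes "i < n"
  shows "kernel_rep n (\<lambda>x y. if x i \<noteq> y i then 1 else 0) (\<lambda>x. 1)"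
  unfolding kernel_rep_def
proof (intro exI[of _ "Suc 0"] exI[of _ "\<lambda>x j a. if j = i \<and> a = 0 then 1 else 0"] conjI allI impI)
  fix x y :: "nat \<Rightarrow> bool"
  have "(\<Sum>j<n. if x j \<noteq> y j then \<Sum>a<Suc 0. (if j = i \<and> a = 0 then 1 else 0) * (if j = i \<and> a = 0 then 1 else 0) else (0::real))
      = (\<Sum>j<n. if j = i then (if x i \<noteq> y i then 1 else 0) else 0)"
    by (rule sum.cong) auto
  then show "(\<Sum>j<n. if x j \<noteq> y j then \<Sum>a<Suc 0. (if j = i \<and> a = 0 then 1 else 0) * (if j = i \<and> a = 0 then 1 else 0) else (0::real))
      = (if x i \<noteq> y i then 1 else 0)"
    using assms by simp
next
  fix x :: "nat \<Rightarrow> bool"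
  have "(\<Sum>j<n. \<Sum>a<Suc 0. (if j = i \<and> a = 0 then 1 else 0)\<^sup>2) = (\<Sum>j<n. if j = i then 1 else (0::real))"
    by (rule sum.cong) auto
  then show "(\<Sum>j<n. \<Sum>a<Suc 0. (if j = i \<and> a = 0 then 1 else 0)\<^sup>2) = (1::real)"
    using assms by simp
qed auto

lemma kernel_rep_zero: "kernel_rep n (\<lambda>x y. 0) (\<lambda>x. 0)"
  unfolding kernel_rep_def by (intro exI[of _ 0] exI[of _ "\<lambda>x j a. 0"]) (auto intro: sum.neutral)

text \<open>Size zero forces all vectors of \<open>x\<close> to vanish. This settles the degenerate
  compositions, whose weights would divide by zero.\<close>

lemma kernel_rep_eq_0:
  assumes "kernel_rep n g s" "s x = 0"
  shows "g x y = 0"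
proof -
  obtain d :: nat and u where 1: "\<And>x j a. a \<ge> d \<Longrightarrow> u x j a = 0"
    "\<And>x. (\<Sum>j<n. \<Sum>a<d. (u x j a)\<^sup>2) = s x"
    "\<And>x y. (\<Sum>j<n. if x j \<noteq> y j then \<Sum>a<d. u x j a * u y j a else 0) = g x y"
    by (rule kernel_repE[OF assms(1)]) blast
  have "\<forall>j<n. (\<Sum>a<d. (u x j a)\<^sup>2) = 0"
    using 1(2)[of x] assms(2) sum_nonneg_eq_0_iff[of "{..<n}" "\<lambda>j. \<Sum>a<d. (u x j a)\<^sup>2"]
    by (simp add: sum_nonneg)
  then have "\<forall>j<n. \<forall>a<d. u x j a = 0"
    by (simp add: sum_nonneg_eq_0_iff)
  then show ?thesis
    unfolding 1(3)[symmetric] by (intro sum.neutral) (auto intro: sum.neutral)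
qed

lemma kernel_rep_nonneg:
  assumes "kernel_rep n g s" shows "s x \<ge> 0"
proof -
  obtain d and u :: "(nat \<Rightarrow> bool) \<Rightarrow> nat \<Rightarrow> nat \<Rightarrow> real" where
    "\<And>x. (\<Sum>j<n. \<Sum>a<d. (u x j a)\<^sup>2) = s x"
    by (rule kernel_repE[OF assms(1)]) blast
  then show ?thesis by (metis (no_types, lifting) sum_nonneg zero_le_power2)
qed

text \<open>A feasible solution of the dual adversary program. Pairs with equal function values are
  unconstrained, a freedom that the compositions below exploit. One order of \<open>x\<close> and
  \<open>y\<close> suffices, since kernels are symmetric.\<close>

definition adv_witness :: "nat \<Rightarrow> ((nat \<Rightarrow> bool) \<Rightarrow> bool) \<Rightarrow> real \<Rightarrow> bool" where
  "adv_witness n f W \<longleftrightarrow> (\<exists>g s. kernel_rep n g s \<and> (\<forall>x. s x \<le> W) \<and>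
     (\<forall>x y. f x \<and> \<not> f y \<longrightarrow> g x y = 1))"

lemma adv_witness_mono: "adv_witness n f W \<Longrightarrow> W \<le> W' \<Longrightarrow> adv_witness n f W'"
  unfolding adv_witness_def by (meson order_trans)

lemma adv_witness_nonneg: "adv_witness n f W \<Longrightarrow> W \<ge> 0"
  unfolding adv_witness_def by (meson order_trans kernel_rep_nonneg)

lemma adv_witness_const: "adv_witness n (\<lambda>x. b) 0"
  unfolding adv_witness_def using kernel_rep_zero by fastforce

lemma adv_witness_literal:
  assumes "i < n" shows "adv_witness n (\<lambda>x. x i = b) 1"
  unfolding adv_witness_def
  by (rule exI, rule exI, rule conjI[OF kernel_rep_var[OF assms]]) auto

lemma adv_witness_not:
  assumes "adv_witness n f W" shows "adv_witness n (\<lambda>x. \<not> f x) W"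
proof -
  obtain g s where g: "kernel_rep n g s" "\<And>x. s x \<le> W" "\<And>x y. f x \<Longrightarrow> \<not> f y \<Longrightarrow> g x y = 1"
    using assms unfolding adv_witness_def by blast
  have sym: "g x y = g y x" for x y
  proof -
    obtain d :: nat and u where "\<And>x y. (\<Sum>j<n. if x j \<noteq> y j then \<Sum>a<d. u x j a * u y j a else 0) = g x y"
      by (rule kernel_repE[OF g(1)]) blast
    note * = this[symmetric]
    show ?thesis unfolding * by (intro sum.cong) (auto simp: mult.commute)
  qed
  then show ?thesis
    unfolding adv_witness_def using g sym by metis
qed

lemma adv_witness_zero_const:
  assumes "adv_witness n f 0" shows "f x = f y"
proof -
  obtain g s where g: "kernel_rep n g s" "\<And>x. s x \<le> 0" "\<And>x y. f x \<Longrightarrow> \<not> f y \<Longrightarrow> g x y = 1"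
    using assms unfolding adv_witness_def by blast
  have "s x = 0" for x using g(2)[of x] kernel_rep_nonneg[OF g(1), of x] by simp
  then have "g x y = 0" for x y using kernel_rep_eq_0[OF g(1)] by blast
  then show ?thesis using g(3) by (metis zero_neq_one)
qed

text \<open>A true input uses only its first true disjunct, a false input uses both. The weights
  \<open>sqrt (A / W1)\<close> and \<open>sqrt (W1 / A)\<close> multiply to 1; they bound the size
  by \<open>A\<close> on true inputs and by \<open>(W1^2 + W2^2) / A = A\<close> on false
  ones.\<close>

lemma adv_witness_or_pos:
  assumes f1: "adv_witness n f1 W1" and f2: "adv_witness n f2 W2" and W: "W1 > 0" "W2 > 0"
  shows "adv_witness n (\<lambda>x. f1 x \<or> f2 x) (sqrt (W1\<^sup>2 + W2\<^sup>2))"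
proof -
  obtain g1 s1 where 1: "kernel_rep n g1 s1" "\<And>x. s1 x \<le> W1" "\<And>x y. f1 x \<Longrightarrow> \<not> f1 y \<Longrightarrow> g1 x y = 1"
    using f1 unfolding adv_witness_def by blast
  obtain g2 s2 where 2: "kernel_rep n g2 s2" "\<And>x. s2 x \<le> W2" "\<And>x y. f2 x \<Longrightarrow> \<not> f2 y \<Longrightarrow> g2 x y = 1"
    using f2 unfolding adv_witness_def by blast
  define A where "A = sqrt (W1\<^sup>2 + W2\<^sup>2)"
  have A: "A > 0" "A\<^sup>2 = W1\<^sup>2 + W2\<^sup>2" using W by (auto simp: A_def add_pos_pos)
  define c1 where "c1 x = (if f1 x then sqrt (A / W1) else if f2 x then 0 else sqrt (W1 / A))" for x
  define c2 where "c2 x = (if f1 x then 0 else if f2 x then sqrt (A / W2) else sqrt (W2 / A))" for x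
  have rep: "kernel_rep n (\<lambda>x y. c1 x * c1 y * g1 x y + c2 x * c2 y * g2 x y)
      (\<lambda>x. (c1 x)\<^sup>2 * s1 x + (c2 x)\<^sup>2 * s2 x)"
    by (intro kernel_rep_add kernel_rep_scale 1 2)
  have "(c1 x)\<^sup>2 * s1 x + (c2 x)\<^sup>2 * s2 x \<le> A" for x
  proof -
    have "(c1 x)\<^sup>2 * s1 x + (c2 x)\<^sup>2 * s2 x \<le> (c1 x)\<^sup>2 * W1 + (c2 x)\<^sup>2 * W2"
      by (intro add_mono mult_left_mono 1 2) auto
    also have "\<dots> \<le> A"
    proof (cases "f1 x \<or> f2 x")
      case False
      then have "(c1 x)\<^sup>2 * W1 + (c2 x)\<^sup>2 * W2 = (W1\<^sup>2 + W2\<^sup>2) / A"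
        using A W by (simp add: c1_def c2_def power2_eq_square add_divide_distrib)
      also have "\<dots> = A" using A by (simp add: field_simps flip: power2_eq_square)
      finally show ?thesis by simp
    qed (use A W in \<open>auto simp: c1_def c2_def\<close>)
    finally show ?thesis .
  qed
  moreover have "c1 x * c1 y * g1 x y + c2 x * c2 y * g2 x y = 1"
    if "f1 x \<or> f2 x" "\<not> (f1 y \<or> f2 y)" for x y
    using that 1(3)[of x y] 2(3)[of x y] A W
    by (auto simp: c1_def c2_def real_sqrt_mult[symmetric])
  ultimately show ?thesis
    using rep unfolding adv_witness_def A_def[symmetric] by blast
qed

text \<open>A disjunct with witness size 0 is constant, so it either decides the disjunction or
  drops out of it.\<close>

lemma adv_witness_or:
  assumes f1: "adv_witness n f1 W1" and f2: "adv_witness n f2 W2"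
  shows "adv_witness n (\<lambda>x. f1 x \<or> f2 x) (sqrt (W1\<^sup>2 + W2\<^sup>2))"
proof -
  have W: "W1 \<ge> 0" "W2 \<ge> 0" using assms adv_witness_nonneg by auto
  consider "W1 > 0" "W2 > 0" | "W1 = 0" | "W2 = 0" using W by linarith
  then show ?thesis
  proof cases
    case 2
    then obtain b where "\<And>x. f1 x = b" using adv_witness_zero_const f1 by metis
    then show ?thesis using 2 W f2 adv_witness_mono[OF adv_witness_const W(2)] by (cases b) auto
  next
    case 3
    then obtain b where "\<And>x. f2 x = b" using adv_witness_zero_const f2 by metis
    then show ?thesis using 3 W f1 adv_witness_mono[OF adv_witness_const W(1)] by (cases b) auto
  qed (use adv_witness_or_pos assms in auto)
qed

lemma adv_witness_and_sqrt:
  assumes "adv_witness n f1 (sqrt N1)" "adv_witness n f2 (sqrt N2)" "N1 \<ge> 0" "N2 \<ge> 0"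
  shows "adv_witness n (\<lambda>x. f1 x \<and> f2 x) (sqrt (N1 + N2))"
  using adv_witness_not[OF adv_witness_or[OF assms(1,2)[THEN adv_witness_not]]] assms(3,4)
  by simp

lemma adv_witness_ball_list_sqrt:
  assumes "\<And>g. g \<in> set gs \<Longrightarrow> adv_witness n (F g) (sqrt (real (N g)))"
  shows "adv_witness n (\<lambda>x. \<forall>g\<in>set gs. F g x) (sqrt (real (\<Sum>g\<leftarrow>gs. N g)))"
  using assms
proof (induction gs)
  case (Cons g gs)
  then show ?case
    using adv_witness_and_sqrt[of n "F g" "real (N g)" "\<lambda>x. \<forall>g\<in>set gs. F g x"] by simp
qed (simp add: adv_witness_const)

lemma adv_witness_literals:
  assumes "finite I" "\<And>i. i \<in> I \<Longrightarrow> i < n"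
  shows "adv_witness n (\<lambda>x. \<forall>i\<in>I. x i = b i) (sqrt (real (card I)))"
  using assms
proof (induction I)
  case (insert i I)
  then show ?case
    using adv_witness_and_sqrt[of n "\<lambda>x. x i = b i" 1 "\<lambda>x. \<forall>i\<in>I. x i = b i" "card I"]
      adv_witness_literal[of i n "b i"] by simp
qed (simp add: adv_witness_const)

text \<open>Inputs that differ at \<open>i\<close> are separated by the kernel of the variable,
  whose weights \<open>sqrt \<alpha>\<close> and \<open>sqrt (1 / \<alpha>)\<close> multiply to 1.
  Inputs that agree at \<open>i\<close> are left to the witness of their branch: \<open>c0\<close>
  and \<open>c1\<close> switch off the other one.\<close>

lemma adv_witness_guess:
  assumes i: "i < n" and \<alpha>: "\<alpha> > 0"
    and f0: "adv_witness n f0 W0" "W0 + \<alpha> \<le> W"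
    and f1: "adv_witness n f1 W1" "W1 + 1 / \<alpha> \<le> W"
  shows "adv_witness n (\<lambda>x. if x i = c then f0 x else f1 x) W"
proof -
  obtain g0 s0 where 0: "kernel_rep n g0 s0" "\<And>x. s0 x \<le> W0" "\<And>x y. f0 x \<Longrightarrow> \<not> f0 y \<Longrightarrow> g0 x y = 1"
    using f0 unfolding adv_witness_def by blast
  obtain g1 s1 where 1: "kernel_rep n g1 s1" "\<And>x. s1 x \<le> W1" "\<And>x y. f1 x \<Longrightarrow> \<not> f1 y \<Longrightarrow> g1 x y = 1"
    using f1 unfolding adv_witness_def by blast
  define a where "a x = (if x i = c then sqrt \<alpha> else sqrt (1 / \<alpha>))" for x
  define c0 :: "(nat \<Rightarrow> bool) \<Rightarrow> real" where "c0 x = (if x i = c then 1 else 0)" for x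
  define c1 :: "(nat \<Rightarrow> bool) \<Rightarrow> real" where "c1 x = (if x i = c then 0 else 1)" for x
  have rep: "kernel_rep n
      (\<lambda>x y. a x * a y * (if x i \<noteq> y i then 1 else 0) + (c0 x * c0 y * g0 x y + c1 x * c1 y * g1 x y))
      (\<lambda>x. (a x)\<^sup>2 * 1 + ((c0 x)\<^sup>2 * s0 x + (c1 x)\<^sup>2 * s1 x))"
    by (intro kernel_rep_add kernel_rep_scale kernel_rep_var 0 1 i)
  have "(a x)\<^sup>2 * 1 + ((c0 x)\<^sup>2 * s0 x + (c1 x)\<^sup>2 * s1 x) \<le> W" for x
    using 0(2)[of x] 1(2)[of x] f0(2) f1(2) \<alpha> by (auto simp: a_def c0_def c1_def real_sqrt_divide power_divide)
  moreover have "a x * a y * (if x i \<noteq> y i then 1 else 0) + (c0 x * c0 y * g0 x y + c1 x * c1 y * g1 x y) = 1"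
    if "if x i = c then f0 x else f1 x" "\<not> (if y i = c then f0 y else f1 y)" for x y
    using that 0(3)[of x y] 1(3)[of x y] \<alpha>
    by (auto simp: a_def c0_def c1_def real_sqrt_mult[symmetric] split: if_splits)
  ultimately show ?thesis
    using rep unfolding adv_witness_def by blast
qed

subsection \<open>Witnesses for formulas\<close>

text \<open>One kind of gate suffices: \<open>Gate s fs\<close> is a conjunction if \<open>s\<close>
  holds and a negated conjunction otherwise, so a disjunction becomes a negated conjunction of
  negated inputs.\<close>

datatype nformula = Lit nat bool | Gate bool "nformula list"

fun neval :: "(nat \<Rightarrow> bool) \<Rightarrow> nformula \<Rightarrow> bool" where
  "neval x (Lit i s) = (x i = s)"
| "neval x (Gate s fs) = ((\<forall>g\<in>set fs. neval x g) = s)"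

fun nvars :: "nformula \<Rightarrow> nat set" where
  "nvars (Lit i s) = {i}"
| "nvars (Gate s fs) = (\<Union>g\<in>set fs. nvars g)"

fun nleaves :: "nformula \<Rightarrow> nat" where
  "nleaves (Lit i s) = 1"
| "nleaves (Gate s fs) = (\<Sum>g\<leftarrow>fs. nleaves g)"

fun ngates :: "nformula \<Rightarrow> nat" where
  "ngates (Lit i s) = 0"
| "ngates (Gate s fs) = 1 + (\<Sum>g\<leftarrow>fs. ngates g)"

text \<open>The Boolean argument records the parity of the negations that are pushed to the leaves.\<close>

fun normalize :: "bool \<Rightarrow> formula \<Rightarrow> nformula" where
  "normalize s (Var i) = Lit i s"
| "normalize s (Neg f) = normalize (\<not> s) f"
| "normalize s (AndG fs) = Gate s (map (normalize True) fs)"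
| "normalize s (OrG fs) = Gate (\<not> s) (map (normalize False) fs)"

lemma neval_normalize: "neval x (normalize s f) = (eval x f = s)"
  by (induction s f rule: normalize.induct) auto

lemma nleaves_normalize: "nleaves (normalize s f) = leaves f"
  by (induction s f rule: normalize.induct) (auto simp: o_def cong: map_cong)

lemma ngates_normalize: "ngates (normalize s f) = gates f"
  by (induction s f rule: normalize.induct) (auto simp: o_def cong: map_cong)

lemma nvars_normalize: "wf_formula n f \<Longrightarrow> nvars (normalize s f) \<subseteq> {..<n}"
  by (induction s f rule: normalize.induct) auto

lemma neval_cong: "(\<And>i. i \<in> nvars f \<Longrightarrow> x i = y i) \<Longrightarrow> neval x f = neval y f"
  by (induction f) auto

lemma adv_witness_eq: "adv_witness n f W \<Longrightarrow> adv_witness n (\<lambda>x. f x = s) W"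
  by (cases s) (use adv_witness_not in auto)

text \<open>Squared sizes add over the inputs of a gate, negation is free, and a literal has size
  1.\<close>

lemma adv_witness_nleaves:
  "nvars f \<subseteq> {..<n} \<Longrightarrow> adv_witness n (\<lambda>x. neval x f) (sqrt (real (nleaves f)))"
proof (induction f)
  case (Lit i s)
  then show ?case using adv_witness_literal[of i n s] by simp
next
  case (Gate s fs)
  have "adv_witness n (\<lambda>x. \<forall>g\<in>set fs. neval x g) (sqrt (real (\<Sum>g\<leftarrow>fs. nleaves g)))"
    by (rule adv_witness_ball_list_sqrt) (use Gate in auto)
  then show ?case using adv_witness_eq by simp
qed

section \<open>Restrictions and decision trees\<close>

definition restrict :: "(nat \<Rightarrow> bool option) \<Rightarrow> (nat \<Rightarrow> bool) \<Rightarrow> nat \<Rightarrow> bool" where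
  "restrict \<rho> x i = (case \<rho> i of None \<Rightarrow> x i | Some b \<Rightarrow> b)"

lemma restrict_upd: "\<rho> i = None \<Longrightarrow> restrict (\<rho>(i \<mapsto> c)) x = restrict \<rho> (x(i := c))"
  by (auto simp: restrict_def fun_eq_iff split: option.splits)

lemma restrict_same: "x i = c \<Longrightarrow> \<rho> i = None \<Longrightarrow> restrict (\<rho>(i \<mapsto> c)) x = restrict \<rho> x"
  by (auto simp: restrict_def fun_eq_iff split: option.splits)

abbreviation unset :: "nat \<Rightarrow> (nat \<Rightarrow> bool option) \<Rightarrow> nat set" where
  "unset n \<rho> \<equiv> {i. i < n \<and> \<rho> i = None}"

lemma card_unset_upd:
  assumes "i \<in> unset n \<rho>" shows "card (unset n \<rho>) = Suc (card (unset n (\<rho>(i \<mapsto> c))))"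
proof -
  have "unset n (\<rho>(i \<mapsto> c)) = unset n \<rho> - {i}" by auto
  then show ?thesis using assms card.remove[of "unset n \<rho>" i] by simp
qed

lemma adv_witness_branch:
  assumes "i < n" "\<alpha> > 0" "\<rho> i = None"
    and "adv_witness n (\<lambda>x. F (restrict (\<rho>(i \<mapsto> c)) x)) W0" "W0 + \<alpha> \<le> W"
    and "adv_witness n (\<lambda>x. F (restrict (\<rho>(i \<mapsto> (\<not> c))) x)) W1" "W1 + 1 / \<alpha> \<le> W"
  shows "adv_witness n (\<lambda>x. F (restrict \<rho> x)) W"
proof -
  have "(\<lambda>x. F (restrict \<rho> x)) = (\<lambda>x. if x i = c then F (restrict (\<rho>(i \<mapsto> c)) x)
      else F (restrict (\<rho>(i \<mapsto> (\<not> c))) x))"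
    using assms(3) by (auto simp: fun_eq_iff restrict_same)
  then show ?thesis using adv_witness_guess[OF assms(1,2,4-7), of c] by simp
qed

text \<open>Every unset variable is queried with \<alpha> equal to 1, so either answer costs 1. This
  yields the bound \<open>n\<close>.\<close>

lemma adv_witness_decision_tree:
  assumes F: "\<And>x y. (\<And>i. i < n \<Longrightarrow> x i = y i) \<Longrightarrow> F x = F y"
  shows "adv_witness n (\<lambda>x. F (restrict \<rho> x)) (real (card (unset n \<rho>)))"
proof (induction "card (unset n \<rho>)" arbitrary: \<rho>)
  case 0
  then have "\<And>i. i < n \<Longrightarrow> \<rho> i \<noteq> None" by simp
  then have "F (restrict \<rho> x) = F (restrict \<rho> y)" for x y
    by (intro F) (fastforce simp: restrict_def)
  then obtain b where "\<And>x. F (restrict \<rho> x) = b" by metis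
  then show ?case using 0(1) adv_witness_const[of n b] by (simp only: flip: 0) simp
next
  case (Suc k)
  then obtain i where i: "i \<in> unset n \<rho>" by (metis card.empty ex_in_conv nat.distinct(1))
  have IH: "adv_witness n (\<lambda>x. F (restrict (\<rho>(i \<mapsto> c)) x)) (real k)" for c
    using Suc(1)[of "\<rho>(i \<mapsto> c)"] Suc(2) card_unset_upd[OF i, of c] by simp
  show ?case
    unfolding Suc(2)[symmetric]
    by (rule adv_witness_branch[OF _ _ _ IH[of True] _ IH, of 1]) (use i in auto)
qed

section \<open>Gates and leaves that survive a restriction\<close>

definition determined :: "(nat \<Rightarrow> bool option) \<Rightarrow> nformula \<Rightarrow> bool" where
  "determined \<rho> f \<longleftrightarrow> (\<forall>x y. neval (restrict \<rho> x) f = neval (restrict \<rho> y) f)"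

lemma determined_upd: "\<rho> i = None \<Longrightarrow> determined \<rho> f \<Longrightarrow> determined (\<rho>(i \<mapsto> c)) f"
  by (simp add: determined_def restrict_upd)

text \<open>A gate is live if neither it nor any gate above it is determined; a determined gate
  takes its whole subtree with it.\<close>

fun live_gates :: "(nat \<Rightarrow> bool option) \<Rightarrow> nformula \<Rightarrow> nat" where
  "live_gates \<rho> (Lit i s) = 0"
| "live_gates \<rho> (Gate s fs) =
    (if determined \<rho> (Gate s fs) then 0 else 1 + (\<Sum>g\<leftarrow>fs. live_gates \<rho> g))"

abbreviation live_inputs :: "nat \<Rightarrow> (nat \<Rightarrow> bool option) \<Rightarrow> nformula list \<Rightarrow> nat set" where
  "live_inputs n \<rho> fs \<equiv> {i \<in> unset n \<rho>. \<exists>s. Lit i s \<in> set fs}"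

text \<open>A variable that feeds one gate several times is counted once for that gate; without this the
  number of live leaves would not be controlled by the number of live gates.\<close>

fun live_leaves :: "nat \<Rightarrow> (nat \<Rightarrow> bool option) \<Rightarrow> nformula \<Rightarrow> nat" where
  "live_leaves n \<rho> (Lit i s) = 0"
| "live_leaves n \<rho> (Gate s fs) =
    (if determined \<rho> (Gate s fs) then 0
     else card (live_inputs n \<rho> fs) + (\<Sum>g\<leftarrow>fs. live_leaves n \<rho> g))"

lemma live_gates_le: "live_gates \<rho> f \<le> ngates f"
  by (induction f) (auto intro!: sum_list_mono)

lemma live_gates_upd_le: "\<rho> i = None \<Longrightarrow> live_gates (\<rho>(i \<mapsto> c)) f \<le> live_gates \<rho> f"
  by (induction f) (auto simp: determined_upd intro!: sum_list_mono)

text \<open>Falsifying one literal falsifies the conjunction, so every live input has a value that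
  kills its gate.\<close>

lemma determined_gate_cases:
  assumes "i \<in> live_inputs n \<rho> fs"
  shows "\<exists>c. determined (\<rho>(i \<mapsto> c)) (Gate s fs)"
proof -
  obtain c where c: "Lit i c \<in> set fs" using assms by auto
  have "neval (restrict (\<rho>(i \<mapsto> (\<not> c))) x) (Gate s fs) = (\<not> s)" for x
    using c by (auto simp: restrict_def intro!: bexI[of _ "Lit i c"])
  then show ?thesis unfolding determined_def by metis
qed

lemma real_sum_list: "real (\<Sum>x\<leftarrow>xs. f x) = (\<Sum>x\<leftarrow>xs. real (f x))"
  by (induction xs) auto

text \<open>Double counting: each pair of a live gate and an unset variable feeding it is charged to
  a value of the variable that determines the gate. The drops in live gates, summed over all
  variables and values, cover these charges.\<close>

lemma live_leaves_le:
  "real (live_leaves n \<rho> f) \<le>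
     (\<Sum>i\<in>unset n \<rho>. \<Sum>c\<in>UNIV. real (live_gates \<rho> f) - real (live_gates (\<rho>(i \<mapsto> c)) f))"
proof (induction f)
  case (Lit i s)
  then show ?case by simp
next
  case (Gate s fs)
  let ?d = "\<lambda>f i c. real (live_gates \<rho> f) - real (live_gates (\<rho>(i \<mapsto> c)) f)"
  let ?det = "\<lambda>i c. determined (\<rho>(i \<mapsto> c)) (Gate s fs)"
  show ?case
  proof (cases "determined \<rho> (Gate s fs)")
    case True
    then have "live_gates (\<rho>(i \<mapsto> c)) (Gate s fs) = 0" if "i \<in> unset n \<rho>" for i c
      using that by (simp add: determined_upd)
    then have "(\<Sum>i\<in>unset n \<rho>. \<Sum>c\<in>UNIV. ?d (Gate s fs) i c) = 0"
      using True by (intro sum.neutral ballI) simp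
    moreover have "live_leaves n \<rho> (Gate s fs) = 0" using True by simp
    ultimately show ?thesis by (simp only: of_nat_0 order_refl)
  next
    case False
    \<comment> \<open>If the gate dies, the drop is 1 plus all live gates below it, hence at least 1
      plus the drops of its inputs.\<close>
    have step: "(if ?det i c then 1 else 0) + (\<Sum>g\<leftarrow>fs. ?d g i c) \<le> ?d (Gate s fs) i c" for i c
    proof -
      have "0 \<le> (\<Sum>g\<leftarrow>fs. real (live_gates (\<rho>(i \<mapsto> c)) g))" by (rule sum_list_nonneg) auto
      then show ?thesis using False by (auto simp: sum_list_subtractf real_sum_list)
    qed
    have "real (card (live_inputs n \<rho> fs)) = (\<Sum>i\<in>unset n \<rho>. if i \<in> live_inputs n \<rho> fs then 1 else 0)"
      by (subst sum.inter_filter[symmetric]) (auto intro!: arg_cong[where f = card])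
    also have "\<dots> \<le> (\<Sum>i\<in>unset n \<rho>. \<Sum>c\<in>UNIV. if ?det i c then 1 else 0)"
    proof (rule sum_mono)
      fix i
      show "(if i \<in> live_inputs n \<rho> fs then 1 else (0::real)) \<le> (\<Sum>c\<in>UNIV. if ?det i c then 1 else 0)"
      proof (cases "i \<in> live_inputs n \<rho> fs")
        case True
        from determined_gate_cases[OF this, of s] obtain c where "?det i c" by blast
        then show ?thesis by (cases c) (auto simp: UNIV_bool)
      qed (auto intro: sum_nonneg)
    qed
    finally have lits: "real (card (live_inputs n \<rho> fs)) \<le> (\<Sum>i\<in>unset n \<rho>. \<Sum>c\<in>UNIV. if ?det i c then 1 else 0)" .
    have "(\<Sum>g\<leftarrow>fs. real (live_leaves n \<rho> g)) \<le> (\<Sum>g\<leftarrow>fs. \<Sum>i\<in>unset n \<rho>. \<Sum>c\<in>UNIV. ?d g i c)"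
      by (rule sum_list_mono) (rule Gate.IH)
    also have "\<dots> = (\<Sum>i\<in>unset n \<rho>. \<Sum>c\<in>UNIV. \<Sum>g\<leftarrow>fs. ?d g i c)"
      by (induction fs) (auto simp: sum.distrib)
    finally have subs: "(\<Sum>g\<leftarrow>fs. real (live_leaves n \<rho> g)) \<le> \<dots>" .
    have "real (live_leaves n \<rho> (Gate s fs)) = real (card (live_inputs n \<rho> fs)) + (\<Sum>g\<leftarrow>fs. real (live_leaves n \<rho> g))"
      using False by (simp add: real_sum_list o_def)
    also have "\<dots> \<le> (\<Sum>i\<in>unset n \<rho>. \<Sum>c\<in>UNIV. (if ?det i c then 1 else 0) + (\<Sum>g\<leftarrow>fs. ?d g i c))"
      using add_mono[OF lits subs] by (simp only: sum.distrib)
    also have "\<dots> \<le> (\<Sum>i\<in>unset n \<rho>. \<Sum>c\<in>UNIV. ?d (Gate s fs) i c)"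
      by (intro sum_mono step)
    finally show ?thesis .
  qed
qed

text \<open>Pigeonhole over the at most \<open>2 * n\<close> pairs of a variable and a
  value.\<close>

lemma heavy_input:
  assumes "real (live_leaves n \<rho> f) > 2 * real n * t" "t \<ge> 0"
  obtains i c where "i \<in> unset n \<rho>"
    "real (live_gates (\<rho>(i \<mapsto> c)) f) + t \<le> real (live_gates \<rho> f)"
proof (rule ccontr)
  note witness = that
  assume "\<not> thesis"
  have *: "real (live_gates \<rho> f) - real (live_gates (\<rho>(i \<mapsto> c)) f) \<le> t"
    if i: "i \<in> unset n \<rho>" for i c
  proof (rule ccontr)
    assume "\<not> real (live_gates \<rho> f) - real (live_gates (\<rho>(i \<mapsto> c)) f) \<le> t"
    then have "real (live_gates (\<rho>(i \<mapsto> c)) f) + t \<le> real (live_gates \<rho> f)" by linarith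
    from witness[OF i this] \<open>\<not> thesis\<close> show False by blast
  qed
  have "real (live_leaves n \<rho> f) \<le> (\<Sum>i\<in>unset n \<rho>. \<Sum>c\<in>(UNIV :: bool set). t)"
    by (rule order_trans[OF live_leaves_le]) (intro sum_mono *)
  also have "\<dots> = 2 * real (card (unset n \<rho>)) * t" by simp
  also have "\<dots> \<le> 2 * real n * t"
    using card_mono[of "{..<n}" "unset n \<rho>"] assms(2) by (intro mult_right_mono) auto
  finally show False using assms(1) by simp
qed

text \<open>Reduces the literals of a live gate to one constraint per unset variable, however often
  the variable occurs. This justifies counting it once in \<open>live_leaves\<close>.\<close>

lemma neval_gate_live:
  assumes live: "\<not> determined \<rho> (Gate s fs)" and fs: "\<forall>i s. Lit i s \<in> set fs \<longrightarrow> i < n"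
  shows "\<exists>b. \<forall>x. (\<forall>g\<in>set fs. neval (restrict \<rho> x) g) \<longleftrightarrow>
    (\<forall>i\<in>live_inputs n \<rho> fs. x i = b i) \<and>
    (\<forall>g\<in>set (filter (\<lambda>g. \<exists>s gs. g = Gate s gs) fs). neval (restrict \<rho> x) g)"
proof -
  define b where "b i = (SOME s. Lit i s \<in> set fs)" for i
  have b: "Lit i (b i) \<in> set fs" if "Lit i s \<in> set fs" for i s
    unfolding b_def using that by (rule someI)
  \<comment> \<open>An undetermined gate takes both values, so some input satisfies all of
    \<open>fs\<close>. Hence unset literals of one variable agree in sign, and literals fixed by
    \<open>\<rho>\<close> hold.\<close>
  obtain x0 where x0: "\<And>g. g \<in> set fs \<Longrightarrow> neval (restrict \<rho> x0) g"
    using live unfolding determined_def by auto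
  have lit: "x i = b i" if "\<forall>g\<in>set fs. neval (restrict \<rho> x) g" "i \<in> live_inputs n \<rho> fs" for x i
  proof -
    obtain s where "Lit i s \<in> set fs" using \<open>i \<in> live_inputs n \<rho> fs\<close> by auto
    then have "neval (restrict \<rho> x) (Lit i (b i))" using that b by blast
    then show ?thesis using \<open>i \<in> live_inputs n \<rho> fs\<close> by (simp add: restrict_def)
  qed
  show ?thesis
  proof (intro exI[of _ b] allI, rule iffI)
    fix x assume "\<forall>g\<in>set fs. neval (restrict \<rho> x) g"
    then show "(\<forall>i\<in>live_inputs n \<rho> fs. x i = b i) \<and>
      (\<forall>g\<in>set (filter (\<lambda>g. \<exists>s gs. g = Gate s gs) fs). neval (restrict \<rho> x) g)"
      using lit by simp
  next
    fix x
    assume *: "(\<forall>i\<in>live_inputs n \<rho> fs. x i = b i) \<and>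
      (\<forall>g\<in>set (filter (\<lambda>g. \<exists>s gs. g = Gate s gs) fs). neval (restrict \<rho> x) g)"
    show "\<forall>g\<in>set fs. neval (restrict \<rho> x) g"
    proof
      fix g assume g: "g \<in> set fs"
      show "neval (restrict \<rho> x) g"
      proof (cases g)
        case (Lit i s)
        show ?thesis
        proof (cases "\<rho> i")
          case None
          then have live: "i \<in> live_inputs n \<rho> fs" using g Lit fs by auto
          have "Lit i (b i) \<in> set fs" using b g Lit by blast
          then have "x0 i = b i" "x0 i = s"
            using x0[of "Lit i (b i)"] x0[OF g] Lit None by (simp_all add: restrict_def)
          moreover have "x i = b i" using * live by blast
          ultimately show ?thesis using None Lit by (simp add: restrict_def)
        qed (use x0[OF g] Lit in \<open>simp add: restrict_def\<close>)
      next
        case (Gate s' gs)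
        then have "g \<in> set (filter (\<lambda>g. \<exists>s gs. g = Gate s gs) fs)" using g by simp
        then show ?thesis using * by blast
      qed
    qed
  qed
qed

text \<open>Same composition as for \<open>nleaves\<close>, with the literals of a gate handled
  together. Literals are counted at the gate they feed and contribute 0 themselves, hence the
  restriction to formulas that are gates.\<close>

lemma adv_witness_live_leaves:
  "nvars f \<subseteq> {..<n} \<Longrightarrow> \<exists>s gs. f = Gate s gs \<Longrightarrow>
   adv_witness n (\<lambda>x. neval (restrict \<rho> x) f) (sqrt (real (live_leaves n \<rho> f)))"
proof (induction f)
  case (Gate s fs)
  show ?case
  proof (cases "determined \<rho> (Gate s fs)")
    case True
    then obtain c where "\<And>x. neval (restrict \<rho> x) (Gate s fs) = c"
      unfolding determined_def by metis
    then show ?thesis using True adv_witness_const[of n c] by simp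
  next
    case False
    let ?gs = "filter (\<lambda>g. \<exists>s gs. g = Gate s gs) fs"
    have "\<forall>i s. Lit i s \<in> set fs \<longrightarrow> i < n" using Gate.prems by force
    from neval_gate_live[OF False this] obtain b where
      b: "\<forall>x. (\<forall>g\<in>set fs. neval (restrict \<rho> x) g) \<longleftrightarrow>
        (\<forall>i\<in>live_inputs n \<rho> fs. x i = b i) \<and> (\<forall>g\<in>set ?gs. neval (restrict \<rho> x) g)"
      by (elim exE)
    have "adv_witness n (\<lambda>x. \<forall>g\<in>set ?gs. neval (restrict \<rho> x) g)
        (sqrt (real (\<Sum>g\<leftarrow>?gs. live_leaves n \<rho> g)))"
      by (rule adv_witness_ball_list_sqrt, rule Gate.IH) (use Gate.prems in auto)
    moreover have "(\<Sum>g\<leftarrow>?gs. live_leaves n \<rho> g) = (\<Sum>g\<leftarrow>fs. live_leaves n \<rho> g)"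
    proof (rule sum_list_map_filter)
      fix g assume "\<not> (\<exists>s gs. g = Gate s gs)"
      then show "live_leaves n \<rho> g = 0" by (cases g) auto
    qed
    ultimately have "adv_witness n (\<lambda>x. \<forall>g\<in>set fs. neval (restrict \<rho> x) g)
        (sqrt (real (card (live_inputs n \<rho> fs)) + real (\<Sum>g\<leftarrow>fs. live_leaves n \<rho> g)))"
      unfolding b[rule_format] by (intro adv_witness_and_sqrt adv_witness_literals) auto
    then show ?thesis using adv_witness_eq[of n _ _ s] False by simp
  qed
qed simp

text \<open>While the live part of the formula has more than \<open>2 * n * t\<close> leaves, some value of some
  variable kills at least \<open>t\<close> gates; query this variable, guessing the other value. Wrong guesses
  are paid for by the killed gates.\<close>

lemma adv_witness_heavy_inputs:
  assumes f: "nvars f \<subseteq> {..<n}" "\<exists>s gs. f = Gate s gs" and t: "t > 0" and \<alpha>: "\<alpha> > 0"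
  shows "adv_witness n (\<lambda>x. neval (restrict \<rho> x) f)
    (\<alpha> * real (card (unset n \<rho>)) + real (live_gates \<rho> f) / (\<alpha> * t) + sqrt (2 * real n * t))"
proof (induction "card (unset n \<rho>)" arbitrary: \<rho> rule: less_induct)
  case less
  let ?W = "\<lambda>\<rho>. \<alpha> * real (card (unset n \<rho>)) + real (live_gates \<rho> f) / (\<alpha> * t) + sqrt (2 * real n * t)"
  show ?case
  proof (cases "real (live_leaves n \<rho> f) > 2 * real n * t")
    case False
    then have "sqrt (real (live_leaves n \<rho> f)) \<le> ?W \<rho>"
      using t \<alpha> by (intro order_trans[OF _ le_add_same_cancel2[THEN iffD2]]) auto
    then show ?thesis using adv_witness_mono adv_witness_live_leaves f by blast
  next
    case True
    from heavy_input[OF this] t obtain i c where i: "i \<in> unset n \<rho>"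
      "real (live_gates (\<rho>(i \<mapsto> c)) f) + t \<le> real (live_gates \<rho> f)" by auto
    have card: "real (card (unset n \<rho>)) = real (card (unset n (\<rho>(i \<mapsto> c)))) + 1" for c
      using card_unset_upd[OF i(1), of c] by simp
    have IH: "adv_witness n (\<lambda>x. neval (restrict (\<rho>(i \<mapsto> c)) x) f) (?W (\<rho>(i \<mapsto> c)))" for c
      by (rule less) (use card_unset_upd[OF i(1), of c] in simp)
    \<comment> \<open>The bound is a potential. Every query uses up an unset variable and releases
      \<alpha>, which pays for a right guess; \<open>t\<close> killed gates release
      \<open>1 / \<alpha>\<close>, which pays for a wrong one.\<close>
    have right: "?W (\<rho>(i \<mapsto> (\<not> c))) + \<alpha> \<le> ?W \<rho>"
    proof -
      have "real (live_gates (\<rho>(i \<mapsto> (\<not> c))) f) / (\<alpha> * t) \<le> real (live_gates \<rho> f) / (\<alpha> * t)"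
        using i t \<alpha> by (intro divide_right_mono) (auto simp: live_gates_upd_le)
      then show ?thesis unfolding card[of "\<not> c"] by (simp add: algebra_simps)
    qed
    have wrong: "?W (\<rho>(i \<mapsto> c)) + 1 / \<alpha> \<le> ?W \<rho>"
    proof -
      have "real (live_gates (\<rho>(i \<mapsto> c)) f) / (\<alpha> * t) + 1 / \<alpha>
          = (real (live_gates (\<rho>(i \<mapsto> c)) f) + t) / (\<alpha> * t)"
        using t \<alpha> by (simp add: field_simps)
      also have "\<dots> \<le> real (live_gates \<rho> f) / (\<alpha> * t)"
        using i t \<alpha> by (intro divide_right_mono) auto
      finally show ?thesis unfolding card[of c] using \<alpha> by (simp add: algebra_simps)
    qed
    show ?thesis
      by (rule adv_witness_branch[of i n \<alpha> \<rho> "\<lambda>x. neval x f" "\<not> c"])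
        (use i \<alpha> right wrong IH[of c] IH[of "\<not> c"] in auto)
  qed
qed

lemma adv_witness_ngates:
  assumes f: "nvars f \<subseteq> {..<n}" "\<exists>s gs. f = Gate s gs" and n: "n \<ge> 1"
  shows "adv_witness n (\<lambda>x. neval x f) (4 * (sqrt (real n) * real (ngates f) powr (1/4)))"
proof -
  define g where "g = real (ngates f) powr (1/4)"
  define m where "m = sqrt (real n)"
  have "ngates f \<ge> 1" using f(2) by auto
  then have g: "g > 0" "real (ngates f) = g ^ 4" by (auto simp: g_def powr_power)
  have m: "m > 0" "real n = m\<^sup>2" using n by (auto simp: m_def)
  \<comment> \<open>The choices \<open>t = g^2\<close>, the square root of the gate count, and
    \<open>\<alpha> = g / m\<close> balance the three terms: each is at most a constant times
    \<open>m * g\<close>.\<close>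
  let ?W = "g / m * real (card (unset n Map.empty)) + real (live_gates Map.empty f) / (g / m * g\<^sup>2)
    + sqrt (2 * real n * g\<^sup>2)"
  have "adv_witness n (\<lambda>x. neval (restrict Map.empty x) f) ?W"
    by (rule adv_witness_heavy_inputs) (use f g m in auto)
  moreover have "restrict Map.empty x = x" for x by (simp add: restrict_def fun_eq_iff)
  moreover have "?W \<le> 4 * (m * g)"
  proof -
    have "g / m * real (card (unset n Map.empty)) = m * g"
      using g m by (simp add: power2_eq_square flip: lessThan_def)
    moreover have "real (live_gates Map.empty f) / (g / m * g\<^sup>2) \<le> m * g"
    proof -
      have "real (live_gates Map.empty f) / (g / m * g\<^sup>2) \<le> g ^ 4 / (g / m * g\<^sup>2)"
        using live_gates_le[of Map.empty f] g m by (intro divide_right_mono) (simp_all flip: g(2))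
      also have "\<dots> = m * g" using g m by (simp add: field_simps power2_eq_square power4_eq_xxxx)
      finally show ?thesis .
    qed
    moreover have "sqrt (2 * real n * g\<^sup>2) \<le> 2 * (m * g)"
      by (rule real_le_lsqrt) (use g m in \<open>auto simp: power_mult_distrib\<close>)
    ultimately show ?thesis by linarith
  qed
  ultimately show ?thesis
    unfolding g_def[symmetric] m_def[symmetric] by (auto elim!: adv_witness_mono)
qed

subsection \<open>Isometries of real coordinate spaces\<close>

definition ip :: "nat \<Rightarrow> (nat \<Rightarrow> real) \<Rightarrow> (nat \<Rightarrow> real) \<Rightarrow> real" where
  "ip D v w = (\<Sum>k<D. v k * w k)"

lemma ip_commute: "ip D v w = ip D w v"
  by (simp add: ip_def mult.commute)

lemma ip_lincomb:
  "ip D (\<lambda>k. a * v k + b * w k) z = a * ip D v z + b * ip D w z"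
  "ip D z (\<lambda>k. a * v k + b * w k) = a * ip D z v + b * ip D z w"
  by (simp_all add: ip_def sum.distrib sum_distrib_left algebra_simps)

lemma ip_scale: "ip D (\<lambda>k. a * v k) z = a * ip D v z" "ip D z (\<lambda>k. a * v k) = a * ip D z v"
  by (simp_all add: ip_def sum_distrib_left mult_ac)

lemma ip_nonneg: "ip D v v \<ge> 0"
  by (simp add: ip_def sum_nonneg)

lemma ip_cong: "(\<And>k. k < D \<Longrightarrow> v k = v' k) \<Longrightarrow> (\<And>k. k < D \<Longrightarrow> w k = w' k) \<Longrightarrow> ip D v w = ip D v' w'"
  by (simp add: ip_def)

lemma ip_self_eq_0: "ip D v v = 0 \<longleftrightarrow> (\<forall>k<D. v k = 0)"
  by (auto simp: ip_def sum_nonneg_eq_0_iff)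

lemma ip_Cauchy_Schwarz: "(ip D v w)\<^sup>2 \<le> ip D v v * ip D w w"
proof -
  have "0 \<le> ip D (\<lambda>k. ip D w w * v k + (- ip D v w) * w k) (\<lambda>k. ip D w w * v k + (- ip D v w) * w k)"
    by (rule ip_nonneg)
  also have "\<dots> = ip D w w * (ip D v v * ip D w w - (ip D v w)\<^sup>2)"
    unfolding ip_lincomb by (simp add: ip_commute[of D w v] algebra_simps power2_eq_square)
  finally have *: "0 \<le> ip D w w * (ip D v v * ip D w w - (ip D v w)\<^sup>2)" .
  show ?thesis
  proof (cases "ip D w w = 0")
    case True
    then have "ip D v w = 0" unfolding ip_self_eq_0 by (simp add: ip_def)
    then show ?thesis using ip_nonneg[of D v] ip_nonneg[of D w] by simp
  next
    case False
    then show ?thesis using * ip_nonneg[of D w] by (simp add: zero_le_mult_iff)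
  qed
qed

definition isometry :: "nat \<Rightarrow> ((nat \<Rightarrow> real) \<Rightarrow> nat \<Rightarrow> real) \<Rightarrow> bool" where
  "isometry D A \<longleftrightarrow>
    (\<forall>a b v w. A (\<lambda>k. a * v k + b * w k) = (\<lambda>k. a * A v k + b * A w k)) \<and>
    (\<forall>v w. ip D (A v) (A w) = ip D v w) \<and> (\<forall>v k. k \<ge> D \<longrightarrow> A v k = 0)"

lemma isometryI:
  assumes "\<And>a b v w k. k < D \<Longrightarrow> A (\<lambda>k. a * v k + b * w k) k = a * A v k + b * A w k"
    and "\<And>v w. ip D (A v) (A w) = ip D v w" and "\<And>v k. k \<ge> D \<Longrightarrow> A v k = 0"
  shows "isometry D A"
  unfolding isometry_def
proof (intro conjI allI impI)
  show "A (\<lambda>k. a * v k + b * w k) = (\<lambda>k. a * A v k + b * A w k)" for a b v w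
    using assms(1,3) by (intro ext) (metis (no_types, lifting) add.right_neutral mult_zero_right not_le)
qed (use assms in auto)

lemma isometry_lincomb:
  "isometry D A \<Longrightarrow> A (\<lambda>k. a * v k + b * w k) = (\<lambda>k. a * A v k + b * A w k)"
  and isometry_ip: "isometry D A \<Longrightarrow> ip D (A v) (A w) = ip D v w"
  and isometry_outside: "isometry D A \<Longrightarrow> k \<ge> D \<Longrightarrow> A v k = 0"
  unfolding isometry_def by blast+

lemma isometry_scale: "isometry D A \<Longrightarrow> A (\<lambda>k. a * v k) = (\<lambda>k. a * A v k)"
  using isometry_lincomb[of D A a v 0 v] by simp

lemma isometry_add: "isometry D A \<Longrightarrow> A (\<lambda>k. v k + w k) = (\<lambda>k. A v k + A w k)"
  using isometry_lincomb[of D A 1 v 1 w] by simp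

lemma isometry_diff: "isometry D A \<Longrightarrow> A (\<lambda>k. v k - w k) = (\<lambda>k. A v k - A w k)"
  using isometry_lincomb[of D A 1 v "-1" w] by simp

lemma isometry_sum:
  assumes "isometry D A" shows "A (\<lambda>k. \<Sum>i\<in>I. f i k) = (\<lambda>k. \<Sum>i\<in>I. A (f i) k)"
proof (induction I rule: infinite_finite_induct)
  case (insert i I)
  then show ?case by (simp add: isometry_add[OF assms])
qed (use isometry_scale[OF assms, of 0] in auto)

text \<open>The difference of \<open>v\<close> and \<open>w\<close> has norm 0, hence so has its
  image. Entries from \<open>D\<close> on therefore never influence an isometry.\<close>

lemma isometry_local:
  assumes "isometry D A" "\<And>k. k < D \<Longrightarrow> v k = w k" shows "A v = A w"
proof -
  have "ip D (A (\<lambda>k. v k - w k)) (A (\<lambda>k. v k - w k)) = 0"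
    unfolding isometry_ip[OF assms(1)] using assms(2) by (simp add: ip_def)
  then have "A v k = A w k" if "k < D" for k
    using that assms(1) unfolding ip_self_eq_0 isometry_diff[OF assms(1)] by auto
  then show ?thesis using isometry_outside[OF assms(1)] by (metis ext not_le)
qed

lemma isometry_comp: "isometry D A \<Longrightarrow> isometry D B \<Longrightarrow> isometry D (\<lambda>v. A (B v))"
  unfolding isometry_def by simp

text \<open>Householder reflection. If \<open>q\<close> vanishes below \<open>D\<close>, the
  quotient is 0 by division by zero, and the map is the identity on entries below
  \<open>D\<close>.\<close>

definition reflect :: "nat \<Rightarrow> (nat \<Rightarrow> real) \<Rightarrow> (nat \<Rightarrow> real) \<Rightarrow> nat \<Rightarrow> real" where
  "reflect D q v = (\<lambda>k. if k < D then v k - 2 * ip D v q / ip D q q * q k else 0)"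

lemma isometry_reflect: "isometry D (reflect D q)"
proof -
  define c where "c = 2 / ip D q q"
  have reflect: "reflect D q v k = 1 * v k + (- c * ip D v q) * q k" if "k < D" for v k
    using that by (simp add: reflect_def c_def)
  show ?thesis
  proof (rule isometryI)
    fix v w
    have "ip D (reflect D q v) (reflect D q w)
        = ip D (\<lambda>k. 1 * v k + (- c * ip D v q) * q k) (\<lambda>k. 1 * w k + (- c * ip D w q) * q k)"
      by (rule ip_cong) (auto simp only: reflect)
    also have "\<dots> = ip D v w + c * ip D v q * ip D w q * (c * ip D q q - 2)"
      unfolding ip_lincomb ip_commute[of D q w] by (simp only: ring_distribs) simp
    also have "c * ip D v q * ip D w q * (c * ip D q q - 2) = 0"
      by (cases "ip D q q = 0") (auto simp: c_def)
    finally show "ip D (reflect D q v) (reflect D q w) = ip D v w" by simp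
  next
    fix a b v w and k :: nat assume k: "k < D"
    show "reflect D q (\<lambda>k. a * v k + b * w k) k = a * reflect D q v k + b * reflect D q w k"
      unfolding reflect[OF k] ip_lincomb by (simp add: algebra_simps)
  qed (simp add: reflect_def)
qed

text \<open>Two unit vectors are swapped by the reflection along their difference. This serves to
  prepare the start of the algorithm and to map the uniform superposition back to a basis
  vector.\<close>

lemma isometry_rotate:
  assumes "ip D a a = 1" "ip D b b = 1"
  obtains A where "isometry D A" "\<And>k. k < D \<Longrightarrow> A a k = b k"
proof
  let ?q = "\<lambda>k. a k - b k"
  show "isometry D (reflect D ?q)" by (rule isometry_reflect)
  have q: "?q = (\<lambda>k. 1 * a k + (-1) * b k)" by simp
  have diff: "ip D a ?q = 1 - ip D a b" "ip D ?q ?q = 2 * (1 - ip D a b)"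
    unfolding q ip_lincomb assms ip_commute[of D b a] by simp_all
  show "reflect D ?q a k = b k" if "k < D" for k
  proof (cases "ip D ?q ?q = 0")
    case True
    then have "a k = b k" using that unfolding ip_self_eq_0 by auto
    then show ?thesis using that by (simp add: reflect_def)
  next
    case False
    then have "2 * ip D a ?q / ip D ?q ?q = 1" unfolding diff by simp
    then show ?thesis using that by (simp add: reflect_def)
  qed
qed

text \<open>Induction on \<open>Y\<close> takes the place of an orthogonal basis of the span.
  Carrying along that \<open>R\<close> is an involution makes it self-adjoint, so that vectors fixed
  by \<open>R\<close> are orthogonal to vectors negated by it.\<close>

lemma isometry_negate_span:
  assumes "finite Y"
  shows "\<exists>R. isometry D R \<and> (\<forall>v. \<forall>k<D. R (R v) k = v k) \<and>
    (\<forall>y\<in>Y. \<forall>k<D. R (q y) k = - q y k) \<and>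
    (\<forall>p. (\<forall>y\<in>Y. ip D p (q y) = 0) \<longrightarrow> (\<forall>k<D. R p k = p k))"
  using assms
proof (induction Y)
  case empty
  show ?case
    by (rule exI[of _ "\<lambda>v k. if k < D then v k else 0"]) (auto intro!: isometryI simp: ip_def)
next
  case (insert y Y)
  then obtain R where R: "isometry D R" "\<And>v k. k < D \<Longrightarrow> R (R v) k = v k"
    "\<And>y k. y \<in> Y \<Longrightarrow> k < D \<Longrightarrow> R (q y) k = - q y k"
    "\<And>p k. (\<And>y. y \<in> Y \<Longrightarrow> ip D p (q y) = 0) \<Longrightarrow> k < D \<Longrightarrow> R p k = p k"
    by blast
  \<comment> \<open>The part of the new vector that \<open>R\<close> fixes; the remaining part is
    already negated. Reflecting along \<open>z\<close> negates it as well and disturbs no vector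
    negated so far.\<close>
  define z where "z = (\<lambda>k. 1/2 * q y k + 1/2 * R (q y) k)"
  have self_adj: "ip D (R v) w = ip D v (R w)" for v w
  proof -
    have "ip D (R v) w = ip D (R (R v)) (R w)" using isometry_ip[OF R(1)] by simp
    also have "\<dots> = ip D v (R w)" by (rule ip_cong) (auto simp: R(2))
    finally show ?thesis .
  qed
  have Rz: "R z k = z k" if "k < D" for k
    unfolding z_def isometry_lincomb[OF R(1)] using R(2)[OF that] by simp
  have z_orth: "ip D z v = 0" if "\<And>k. k < D \<Longrightarrow> R v k = - v k" for v
  proof -
    have "ip D z v = ip D (R z) v" by (rule ip_cong) (auto simp: Rz)
    also have "\<dots> = ip D z (R v)" by (rule self_adj)
    also have "\<dots> = ip D z (\<lambda>k. -1 * v k)" by (rule ip_cong) (auto simp: that)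
    finally show ?thesis unfolding ip_scale by simp
  qed
  define R' where "R' = (\<lambda>v. R (reflect D z v))"
  have R': "isometry D R'" unfolding R'_def by (rule isometry_comp[OF R(1) isometry_reflect])
  have R'_alt: "R' v k = R v k - 2 * ip D v z / ip D z z * z k" if "k < D" for v k
  proof -
    have "R' v = R (\<lambda>k. 1 * v k + (- (2 * ip D v z / ip D z z)) * z k)"
      unfolding R'_def by (rule isometry_local[OF R(1)]) (simp add: reflect_def)
    then show ?thesis unfolding isometry_lincomb[OF R(1)] using Rz[OF that] by simp
  qed
  show ?case
  proof (intro exI[of _ R'] conjI ballI allI impI R')
    fix v k assume k: "k < D"
    let ?a = "2 * ip D v z / ip D z z"
    have "ip D (R v) z = ip D v (R z)" by (rule self_adj)
    also have "\<dots> = ip D v z" by (rule ip_cong) (auto simp: Rz)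
    finally have e: "ip D (R v) z = ip D v z" .
    have "R' (R' v) = R' (\<lambda>k. 1 * R v k + (- ?a) * z k)"
      by (rule isometry_local[OF R']) (simp add: R'_alt)
    then have "R' (R' v) k = R' (R v) k - ?a * R' z k"
      unfolding isometry_lincomb[OF R'] by simp
    also have "\<dots> = v k - ?a * z k - ?a * (z k - 2 * ip D z z / ip D z z * z k)"
      unfolding R'_alt[OF k] e by (simp add: R(2) Rz k)
    also have "\<dots> = v k" by (cases "ip D z z = 0") (auto simp: algebra_simps)
    finally show "R' (R' v) k = v k" .
  next
    fix y' k assume y': "y' \<in> insert y Y" and k: "k < D"
    show "R' (q y') k = - q y' k"
    proof (cases "y' \<in> Y")
      case True
      then have "ip D z (q y') = 0" by (intro z_orth R(3))
      then show ?thesis using True k by (simp add: R'_alt ip_commute[of D "q y'"] R(3))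
    next
      case False
      then have [simp]: "y' = y" using y' by simp
      define w where "w = (\<lambda>k. 1/2 * q y k + (- 1/2) * R (q y) k)"
      have "R w k = - w k" if "k < D" for k
        unfolding w_def isometry_lincomb[OF R(1)] using R(2)[OF that] by simp
      then have zw: "ip D z w = 0" by (rule z_orth)
      have qzw: "q y = (\<lambda>k. 1 * z k + 1 * w k)" by (simp add: z_def w_def fun_eq_iff)
      have "ip D (q y) z = ip D z z"
        unfolding qzw ip_lincomb using zw by (simp add: ip_commute[of D w])
      then have "R' (q y) k = R (q y) k - 2 * (ip D z z / ip D z z) * z k"
        using k by (simp add: R'_alt)
      \<comment> \<open>If \<open>z\<close> vanishes, the quotient is 0 instead of 1, but then
        \<open>z k\<close> is 0 too.\<close>
      also have "2 * (ip D z z / ip D z z) * z k = 2 * z k"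
        using ip_self_eq_0[of D z] k by (cases "ip D z z = 0") auto
      finally show ?thesis by (simp add: z_def)
    qed
  next
    fix p k assume p: "\<forall>y\<in>insert y Y. ip D p (q y) = 0" and k: "k < D"
    have Rp: "R p k = p k" if "k < D" for k using R(4)[OF _ that] p by simp
    have "ip D p (R (q y)) = ip D (R p) (q y)" by (simp add: self_adj)
    also have "\<dots> = ip D p (q y)" by (rule ip_cong) (auto simp: Rp)
    finally have "ip D p z = 0" unfolding z_def ip_lincomb using p by simp
    then show "R' p k = p k" using k by (simp add: R'_alt Rp)
  qed
qed

subsection \<open>Circuits from real isometries\<close>

definition real_mat :: "((nat \<Rightarrow> real) \<Rightarrow> nat \<Rightarrow> real) \<Rightarrow> nat \<Rightarrow> nat \<Rightarrow> complex" where
  "real_mat A k j = complex_of_real (A (\<lambda>i. if i = j then 1 else 0) k)"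

lemma unitary_real_mat:
  assumes "isometry D A" shows "unitary_mat D (real_mat A)"
  unfolding unitary_mat_def
proof (intro allI impI)
  fix j k assume jk: "j < D" "k < D"
  let ?e = "\<lambda>j i. if i = j then 1 else (0::real)"
  have "(\<Sum>i<D. cnj (real_mat A i j) * real_mat A i k) = complex_of_real (ip D (A (?e j)) (A (?e k)))"
    by (simp add: real_mat_def ip_def)
  also have "ip D (A (?e j)) (A (?e k)) = ip D (?e j) (?e k)"
    by (rule isometry_ip[OF assms])
  also have "\<dots> = (if j = k then 1 else 0)"
  proof -
    have "ip D (?e j) (?e k) = (\<Sum>i<D. if i = j then (if j = k then 1 else 0) else 0)"
      unfolding ip_def by (rule sum.cong) auto
    then show ?thesis using jk by simp
  qed
  finally show "(\<Sum>i<D. cnj (real_mat A i j) * real_mat A i k) = (if j = k then 1 else 0)"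
    by simp
qed

lemma apply_real_mat:
  assumes "isometry D A"
  shows "apply_mat D (real_mat A) (\<lambda>k. complex_of_real (v k)) = (\<lambda>k. complex_of_real (A v k))"
proof
  fix k
  let ?e = "\<lambda>j i. if i = j then 1 else (0::real)"
  show "apply_mat D (real_mat A) (\<lambda>k. complex_of_real (v k)) k = complex_of_real (A v k)"
  proof (cases "k < D")
    case True
    have "(\<Sum>j<D. A (?e j) k * v j) = (\<Sum>j<D. A (\<lambda>i. v j * ?e j i) k)"
      unfolding isometry_scale[OF assms] by (simp add: mult.commute)
    also have "\<dots> = A (\<lambda>i. \<Sum>j<D. v j * ?e j i) k"
      unfolding isometry_sum[OF assms] ..
    also have "A (\<lambda>i. \<Sum>j<D. v j * ?e j i) = A v"
    proof (rule isometry_local[OF assms])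
      fix i assume "i < D"
      have "(\<Sum>j<D. v j * ?e j i) = (\<Sum>j<D. if j = i then v i else 0)"
        by (rule sum.cong) auto
      then show "(\<Sum>j<D. v j * ?e j i) = v i" using \<open>i < D\<close> by simp
    qed
    finally have "complex_of_real (\<Sum>j<D. A (?e j) k * v j) = complex_of_real (A v k)" by simp
    then show ?thesis using True by (simp add: apply_mat_def real_mat_def)
  qed (simp add: apply_mat_def isometry_outside[OF assms])
qed

definition real_query :: "nat \<Rightarrow> nat \<Rightarrow> (nat \<Rightarrow> bool) \<Rightarrow> (nat \<Rightarrow> real) \<Rightarrow> nat \<Rightarrow> real" where
  "real_query D n x v = (\<lambda>k. if k < D then v (qop_idx n x k) else 0)"

lemma query_op_real:
  "query_op D n x (\<lambda>k. complex_of_real (v k)) = (\<lambda>k. complex_of_real (real_query D n x v k))"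
  by (auto simp: query_op_def real_query_def)

lemma qrun_real:
  assumes "\<And>A. A \<in> set As \<Longrightarrow> isometry D A"
  shows "qrun D n x (map real_mat As) (\<lambda>k. complex_of_real (v k)) =
    (\<lambda>k. complex_of_real (fold (\<lambda>A v. A (real_query D n x v)) As v k))"
  using assms by (induction As arbitrary: v) (auto simp: query_op_real apply_real_mat)

text \<open>Passage from complex circuits to real spaces: it remains to supply isometries, each
  member of \<open>As\<close> being preceded by one query.\<close>

lemma computes_with_real_queries:
  assumes "m \<ge> 1" and D: "D = 2 * n * m"
    and A0: "isometry D A0" and As: "\<And>A. A \<in> set As \<Longrightarrow> isometry D A"
    and prob: "\<And>x. (\<Sum>k | k < D \<and> out k = f x.
      (fold (\<lambda>A v. A (real_query D n x v)) As (A0 (\<lambda>k. if k = 0 then 1 else 0)) k)\<^sup>2) \<ge> 2 / 3"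
  shows "computes_with_queries n f (length As)"
proof -
  have init: "init_state = (\<lambda>k. complex_of_real (if k = 0 then 1 else 0))"
    by (auto simp: init_state_def)
  have "final_state D n x (real_mat A0) (map real_mat As) =
    (\<lambda>k. complex_of_real (fold (\<lambda>A v. A (real_query D n x v)) As (A0 (\<lambda>k. if k = 0 then 1 else 0)) k))" for x
    unfolding final_state_def init apply_real_mat[OF A0] by (rule qrun_real[OF As])
  then have "out_prob D n x (real_mat A0) (map real_mat As) out (f x) \<ge> 2 / 3" for x
    using prob[of x] by (simp add: out_prob_def)
  then show ?thesis
    unfolding computes_with_queries_def
    using assms(1) unitary_real_mat[OF A0] unitary_real_mat[OF As] unfolding D
    by (intro exI[of _ m] conjI exI[of _ "real_mat A0"] exI[of _ "map real_mat As"] exI[of _ out]) auto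
qed

section \<open>Coordinates of basis indices and the query permutation\<close>

lemma index_coords:
  assumes "j < n" "b < 2"
  shows "(j + n * (b + 2 * w)) mod n = j" "(j + n * (b + 2 * w)) div n mod 2 = b"
    "(j + n * (b + 2 * w)) div (2 * n) = (w::nat)"
proof -
  have "(j + n * (b + 2 * w)) div n = b + 2 * w" using assms by simp
  then show "(j + n * (b + 2 * w)) div n mod 2 = b" "(j + n * (b + 2 * w)) div (2 * n) = w"
    using assms by (auto simp: mult.commute[of 2 n] div_mult2_eq)
qed (use assms in simp)

lemma index_eq: "k = k mod n + n * (k div n mod 2 + 2 * (k div (2 * n)))" for k n :: nat
  by (simp add: mult.commute[of 2 n] div_mult2_eq)

lemma qop_idx_coords:
  assumes "j < n" "b < 2"
  shows "qop_idx n x (j + n * (b + 2 * w)) = j + n * ((if x j then 1 - b else b) + 2 * w)"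
proof -
  have "b = 0 \<or> b = 1" using assms by auto
  then show ?thesis
    unfolding qop_idx_def index_coords[OF assms] by (auto simp: algebra_simps)
qed

lemma index_less:
  assumes "j < n" "b < 2" shows "j + n * (b + 2 * w) < 2 * n * m \<longleftrightarrow> w < (m::nat)"
proof -
  have "0 < n" using assms by simp
  have "j + n * (b + 2 * w) < 2 * n * m \<longleftrightarrow> (j + n * (b + 2 * w)) div (2 * n) < m"
    using \<open>0 < n\<close> by (simp add: div_less_iff_less_mult mult.commute)
  then show ?thesis unfolding index_coords[OF assms] .
qed

lemma qop_idx_less: "n \<ge> 1 \<Longrightarrow> qop_idx n x k < 2 * n * m \<longleftrightarrow> k < 2 * n * m"
proof -
  assume n: "n \<ge> 1"
  define j b w where "j = k mod n" and "b = k div n mod 2" and "w = k div (2 * n)"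
  have k: "k = j + n * (b + 2 * w)" and jb: "j < n" "b < 2"
    using n index_eq[of k n] by (auto simp: j_def b_def w_def)
  have b': "(if x j then 1 - b else b) < 2" using jb by auto
  show ?thesis
    unfolding k qop_idx_coords[OF jb] index_less[OF jb] index_less[OF jb(1) b'] ..
qed

lemma qop_idx_involution: "n \<ge> 1 \<Longrightarrow> qop_idx n x (qop_idx n x k) = k"
proof -
  assume n: "n \<ge> 1"
  define j b w where "j = k mod n" and "b = k div n mod 2" and "w = k div (2 * n)"
  have k: "k = j + n * (b + 2 * w)" and jb: "j < n" "b < 2"
    using n index_eq[of k n] by (auto simp: j_def b_def w_def)
  have b': "(if x j then 1 - b else b) < 2" using jb by auto
  show ?thesis
    unfolding k qop_idx_coords[OF jb] qop_idx_coords[OF jb(1) b'] using jb by auto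
qed

lemma isometry_real_query:
  assumes "n \<ge> 1" "D = 2 * n * m"
  shows "isometry D (real_query D n x)"
proof (rule isometryI)
  fix v w :: "nat \<Rightarrow> real"
  have "(\<Sum>k<D. v (qop_idx n x k) * w (qop_idx n x k)) = (\<Sum>k<D. v k * w k)"
    by (rule sum.reindex_bij_witness[of _ "qop_idx n x" "qop_idx n x"])
      (use assms in \<open>auto simp: qop_idx_involution qop_idx_less\<close>)
  then show "ip D (real_query D n x v) (real_query D n x w) = ip D v w"
    by (simp add: ip_def real_query_def)
qed (auto simp: real_query_def)

section \<open>An additional register on top of the query space\<close>

definition block :: "nat \<Rightarrow> (nat \<Rightarrow> real) \<Rightarrow> nat \<Rightarrow> nat \<Rightarrow> real" where
  "block E v t = (\<lambda>e. v (e + E * t))"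

lemma sum_blocks: "(\<Sum>k<E * T. f k) = (\<Sum>t<T. \<Sum>e<E. f (e + E * t :: nat))"
  for f :: "nat \<Rightarrow> 'a::comm_monoid_add"
proof (induction T)
  case (Suc T)
  have "(\<Sum>k<E * Suc T. f k) = (\<Sum>k\<in>{..<E * T} \<union> {E * T..<E * T + E}. f k)"
    by (rule sum.cong) auto
  also have "\<dots> = (\<Sum>k<E * T. f k) + (\<Sum>k=E * T..<E * T + E. f k)"
    by (rule sum.union_disjoint) auto
  also have "(\<Sum>k=E * T..<E * T + E. f k) = (\<Sum>e<E. f (e + E * T))"
    using sum.shift_bounds_nat_ivl[of f 0 "E * T" E] by (simp only: add_0 add.commute[of E] lessThan_atLeast0)
  finally show ?case using Suc by simp
qed simp

lemma ip_blocks: "ip (E * T) v w = (\<Sum>t<T. ip E (block E v t) (block E w t))"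
  by (simp add: ip_def block_def sum_blocks)

lemma block_index_less: "e < E \<Longrightarrow> t < T \<Longrightarrow> e + E * t < E * (T::nat)"
proof -
  assume "e < E" "t < T"
  then have "e + E * t < E * Suc t" "E * Suc t \<le> E * T"
    by (simp, intro mult_le_mono2) simp
  then show ?thesis by (rule less_le_trans)
qed

text \<open>\<open>A\<close> controlled by the register \<open>t\<close>: blocks outside
  \<open>P\<close> are left alone.\<close>

definition on_blocks ::
  "nat \<Rightarrow> nat \<Rightarrow> (nat \<Rightarrow> bool) \<Rightarrow> ((nat \<Rightarrow> real) \<Rightarrow> nat \<Rightarrow> real) \<Rightarrow> (nat \<Rightarrow> real) \<Rightarrow> nat \<Rightarrow> real" where
  "on_blocks E T P A v = (\<lambda>k. if k < E * T then
     (if P (k div E) then A (block E v (k div E)) (k mod E) else v k) else 0)"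

lemma block_on_blocks:
  assumes "e < E" "t < T"
  shows "block E (on_blocks E T P A v) t e = (if P t then A (block E v t) e else block E v t e)"
  using assms block_index_less[OF assms] by (simp add: on_blocks_def block_def)

lemma block_lincomb: "block E (\<lambda>k. a * v k + b * w k) t = (\<lambda>e. a * block E v t e + b * block E w t e)"
  by (simp add: block_def)

lemma isometry_on_blocks:
  assumes "isometry E A" shows "isometry (E * T) (on_blocks E T P A)"
proof (rule isometryI)
  fix v w :: "nat \<Rightarrow> real"
  have "ip E (block E (on_blocks E T P A v) t) (block E (on_blocks E T P A w) t)
      = ip E (block E v t) (block E w t)" if t: "t < T" for t
  proof -
    have "ip E (block E (on_blocks E T P A v) t) (block E (on_blocks E T P A w) t)
      = ip E (if P t then A (block E v t) else block E v t) (if P t then A (block E w t) else block E w t)"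
      by (rule ip_cong) (auto simp: block_on_blocks t)
    then show ?thesis using isometry_ip[OF assms] by simp
  qed
  then show "ip (E * T) (on_blocks E T P A v) (on_blocks E T P A w) = ip (E * T) v w"
    unfolding ip_blocks by simp
qed (auto simp: on_blocks_def block_lincomb isometry_lincomb[OF assms])

text \<open>\<open>H\<close> on the register \<open>t\<close>, tensored with the identity within the
  blocks.\<close>

definition across_blocks ::
  "nat \<Rightarrow> nat \<Rightarrow> ((nat \<Rightarrow> real) \<Rightarrow> nat \<Rightarrow> real) \<Rightarrow> (nat \<Rightarrow> real) \<Rightarrow> nat \<Rightarrow> real" where
  "across_blocks E T H v = (\<lambda>k. if k < E * T then H (\<lambda>t. block E v t (k mod E)) (k div E) else 0)"

lemma block_across_blocks:
  assumes "e < E" "t < T"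
  shows "block E (across_blocks E T H v) t e = H (\<lambda>t. block E v t e) t"
  using assms block_index_less[OF assms] by (simp add: across_blocks_def block_def)

lemma isometry_across_blocks:
  assumes "isometry T H" shows "isometry (E * T) (across_blocks E T H)"
proof (rule isometryI)
  fix v w :: "nat \<Rightarrow> real"
  have fibers: "ip (E * T) v w = (\<Sum>e<E. ip T (\<lambda>t. block E v t e) (\<lambda>t. block E w t e))" for v w
    unfolding ip_blocks unfolding ip_def by (rule sum.swap)
  have "ip T (\<lambda>t. block E (across_blocks E T H v) t e) (\<lambda>t. block E (across_blocks E T H w) t e)
      = ip T (\<lambda>t. block E v t e) (\<lambda>t. block E w t e)" if e: "e < E" for e
  proof -
    have "ip T (\<lambda>t. block E (across_blocks E T H v) t e) (\<lambda>t. block E (across_blocks E T H w) t e)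
      = ip T (H (\<lambda>t. block E v t e)) (H (\<lambda>t. block E w t e))"
      by (rule ip_cong) (auto simp: block_across_blocks e)
    then show ?thesis using isometry_ip[OF assms] by simp
  qed
  then show "ip (E * T) (across_blocks E T H v) (across_blocks E T H w) = ip (E * T) v w"
    unfolding fibers by simp
qed (auto simp: across_blocks_def block_lincomb isometry_lincomb[OF assms])

lemma qop_idx_block:
  assumes "n \<ge> 1" "E = 2 * n * m"
  shows "qop_idx n x (e + E * t) = qop_idx n x e + E * t"
proof -
  define j b w where "j = e mod n" and "b = e div n mod 2" and "w = e div (2 * n)"
  have e: "e = j + n * (b + 2 * w)" and jb: "j < n" "b < 2"
    using assms(1) index_eq[of e n] by (auto simp: j_def b_def w_def)
  have et: "e + E * t = j + n * (b + 2 * (w + m * t))"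
    unfolding e assms(2) by (simp add: algebra_simps)
  show ?thesis
    unfolding et unfolding e qop_idx_coords[OF jb] assms(2) by (simp add: algebra_simps)
qed

lemma block_real_query:
  assumes "n \<ge> 1" "E = 2 * n * m" "e < E" "t < T"
  shows "block E (real_query (E * T) n x v) t e = real_query E n x (block E v t) e"
  using block_index_less[OF assms(3,4)] assms(3)
  by (simp add: block_def real_query_def qop_idx_block[OF assms(1,2)])

subsection \<open>Averaging the iterates of an isometry\<close>

text \<open>The register \<open>t\<close> is prepared in the uniform superposition over \<open>{..<T}\<close>. The branch \<open>t\<close> spends the
  first \<open>T - t\<close> queries idling on a state that is invariant under queries, so that no controlled
  query is needed, and then applies the step operator \<open>t\<close> times. Projecting the register back onto
  the uniform superposition leaves the average of the iterates.\<close>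

lemma computes_with_averaging:
  fixes f :: "(nat \<Rightarrow> bool) \<Rightarrow> bool"
  assumes n: "n \<ge> 1" and m: "m \<ge> 1" and E: "E = 2 * n * m" and T: "T \<ge> 1"
    and V: "isometry E V" and s0: "ip E s0 s0 = 1"
    and inv: "\<And>x e. e < E \<Longrightarrow> real_query E n x s0 e = s0 e"
  defines "avg \<equiv> \<lambda>x e. (\<Sum>t<T. ((\<lambda>v. V (real_query E n x v)) ^^ t) s0 e) / real T"
  assumes acc: "\<And>x. f x \<Longrightarrow> ip E (avg x) (avg x) \<ge> 2 / 3"
    and rej: "\<And>x. \<not> f x \<Longrightarrow> ip E (avg x) (avg x) \<le> 1 / 3"
  shows "computes_with_queries n f (T + 1)"
proof -
  define r where "r = 1 / sqrt (real T)"
  have r: "r * r * real T = 1" "r * r = 1 / real T" using T by (auto simp: r_def)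
  define D where "D = E * T"
  have D: "D = 2 * n * (m * T)" by (simp add: D_def E)
  have E0: "0 < E" using n m E by simp
  define U where "U x v = V (real_query E n x v)" for x v
  let ?e0 = "\<lambda>k. if k = 0 then 1 else (0::real)"
  have e0: "ip D ?e0 ?e0 = 1" if "0 < D" for D :: nat
  proof -
    have "ip D ?e0 ?e0 = (\<Sum>k<D. if k = 0 then 1 else 0)"
      unfolding ip_def by (rule sum.cong) auto
    then show ?thesis using that by simp
  qed
  define start where "start k = r * s0 (k mod E)" for k
  have block_start: "block E start t e = r * s0 e" if "e < E" for t e
    using that by (simp add: block_def start_def)
  have "ip D start start = (\<Sum>t<T. ip E (\<lambda>e. r * s0 e) (\<lambda>e. r * s0 e))"
    unfolding D_def ip_blocks by (intro sum.cong refl ip_cong block_start)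
  also have "\<dots> = 1" unfolding ip_scale s0 using r by simp
  finally have start: "ip D start start = 1" .
  obtain A0 where A0: "isometry D A0" "\<And>k. k < D \<Longrightarrow> A0 ?e0 k = start k"
    by (rule isometry_rotate[OF e0 start]) (use E0 T D_def in auto)
  have "ip T (\<lambda>_. r) (\<lambda>_. r) = 1" using r by (simp add: ip_def)
  from isometry_rotate[OF this e0] T obtain H where
    H: "isometry T H" "\<And>t. t < T \<Longrightarrow> H (\<lambda>_. r) t = ?e0 t" by auto
  define M where "M l = on_blocks E T (\<lambda>t. l < t) V" for l
  \<comment> \<open>The thresholds \<open>l\<close> run from \<open>T - 1\<close> down to 0, so
    branch \<open>t\<close> idles for \<open>T - t\<close> queries and then makes \<open>t\<close>
    steps. The closing isometry is preceded by one more query, hence \<open>T + 1\<close> in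
    total.\<close>
  define As where "As = map M (rev [0..<T]) @ [across_blocks E T H]"
  have isoM: "isometry D (M l)" for l
    unfolding M_def D_def by (rule isometry_on_blocks[OF V])
  have isoH: "isometry D (across_blocks E T H)"
    unfolding D_def by (rule isometry_across_blocks[OF H(1)])
  have isoAs: "isometry D A" if "A \<in> set As" for A
    using that isoM isoH by (auto simp: As_def)
  let ?run = "\<lambda>x As v. fold (\<lambda>A v. A (real_query D n x v)) As v"
  have norm: "ip D (?run x As v) (?run x As v) = ip D v v" if "\<And>A. A \<in> set As \<Longrightarrow> isometry D A" for x As v
    using that
    by (induction As arbitrary: v) (auto simp: isometry_ip isometry_ip[OF isometry_real_query[OF n D]])
  \<comment> \<open>Invariant with \<open>l\<close> operators left: branch \<open>t\<close> has made
    \<open>t - l\<close> steps, where truncated subtraction gives 0 for branches that still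
    idle.\<close>
  have blocks: "block E (?run x (map M (rev [0..<l])) v) t e = r * (U x ^^ t) s0 e"
    if "\<And>t e. t < T \<Longrightarrow> e < E \<Longrightarrow> block E v t e = r * (U x ^^ (t - l)) s0 e" "t < T" "e < E" for x l v t e
    using that
  proof (induction l arbitrary: v t e)
    case (Suc l)
    have "block E (M l (real_query D n x v)) t e = r * (U x ^^ (t - l)) s0 e" if te: "t < T" "e < E" for t e
    proof -
      have q: "block E (real_query D n x v) t e = real_query E n x (\<lambda>e. r * (U x ^^ (t - Suc l)) s0 e) e"
        if "e < E" for e
      proof -
        have "block E (real_query D n x v) t e = real_query E n x (block E v t) e"
          unfolding D_def by (rule block_real_query[OF n E that te(1)])
        also have "real_query E n x (block E v t) = real_query E n x (\<lambda>e. r * (U x ^^ (t - Suc l)) s0 e)"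
          by (rule isometry_local[OF isometry_real_query[OF n E]]) (rule Suc.prems(1)[OF te(1)])
        finally show ?thesis .
      qed
      show ?thesis
      proof (cases "l < t")
        case True
        have "block E (M l (real_query D n x v)) t e = V (block E (real_query D n x v) t) e"
          using True te by (simp add: M_def block_on_blocks)
        also have "V (block E (real_query D n x v) t) = V (real_query E n x (\<lambda>e. r * (U x ^^ (t - Suc l)) s0 e))"
          by (rule isometry_local[OF V q])
        also have "\<dots> e = r * U x ((U x ^^ (t - Suc l)) s0) e"
          unfolding isometry_scale[OF isometry_real_query[OF n E]] isometry_scale[OF V] U_def ..
        also have "U x ((U x ^^ (t - Suc l)) s0) = (U x ^^ (t - l)) s0"
          using True by (metis Suc_diff_Suc funpow.simps(2) o_apply)
        finally show ?thesis .
      next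
        case False
        then have "block E (M l (real_query D n x v)) t e = real_query E n x (\<lambda>e. r * s0 e) e"
          using te q[OF te(2)] by (simp add: M_def block_on_blocks)
        then show ?thesis
          unfolding isometry_scale[OF isometry_real_query[OF n E]] using False te inv by simp
      qed
    qed
    then show ?case using Suc.IH[of "M l (real_query D n x v)"] Suc.prems(2,3) by simp
  qed simp
  define fin where "fin x = ?run x As (A0 ?e0)" for x
  have fin_norm: "ip D (fin x) (fin x) = 1" for x
  proof -
    have "ip D (fin x) (fin x) = ip D (A0 ?e0) (A0 ?e0)"
      unfolding fin_def by (rule norm) (rule isoAs)
    then show ?thesis unfolding isometry_ip[OF A0(1)] using e0[of D] E0 T by (simp add: D_def)
  qed
  \<comment> \<open>The query before the closing isometry acts on the average. Being an isometry, it
    does not change the norm of block 0.\<close>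
  have fin_block: "block E (fin x) 0 e = real_query E n x (avg x) e" if e: "e < E" for x e
  proof -
    let ?v = "?run x (map M (rev [0..<T])) (A0 ?e0)"
    let ?w = "\<lambda>t. block E (real_query D n x ?v) t e"
    have v: "block E ?v t e = r * (U x ^^ t) s0 e" if "t < T" "e < E" for t e
    proof (rule blocks[OF _ that])
      fix t e assume "t < T" "e < E"
      then show "block E (A0 ?e0) t e = r * (U x ^^ (t - T)) s0 e"
        using A0(2)[of "e + E * t"] block_index_less[of e E t T] block_start[of e t]
        by (simp add: block_def D_def)
    qed
    have "block E (fin x) 0 e = H ?w 0"
      unfolding fin_def As_def using block_across_blocks[OF e, of 0 T H] T by simp
    \<comment> \<open>Entry 0 is the inner product with \<open>H (\<lambda>_. r)\<close>, the first
      basis vector. Removing \<open>H\<close> from both sides leaves the sum weighted by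
      \<open>r\<close>.\<close>
    also have "\<dots> = ip T (H (\<lambda>_. r)) (H ?w)"
    proof -
      have "ip T (H (\<lambda>_. r)) (H ?w) = (\<Sum>t<T. if t = 0 then H ?w 0 else 0)"
        unfolding ip_def by (rule sum.cong) (auto simp: H(2))
      then show ?thesis using T by simp
    qed
    also have "\<dots> = (\<Sum>t<T. r * ?w t)"
      unfolding isometry_ip[OF H(1)] by (simp add: ip_def)
    also have "\<dots> = (\<Sum>t<T. r * real_query E n x (\<lambda>e. r * (U x ^^ t) s0 e) e)"
    proof (rule sum.cong[OF refl])
      fix t assume "t \<in> {..<T}"
      then have t: "t < T" by simp
      have "?w t = real_query E n x (block E ?v t) e"
        unfolding D_def by (rule block_real_query[OF n E e t])
      also have "real_query E n x (block E ?v t) = real_query E n x (\<lambda>e. r * (U x ^^ t) s0 e)"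
        by (rule isometry_local[OF isometry_real_query[OF n E]]) (rule v[OF t])
      finally show "r * ?w t = r * real_query E n x (\<lambda>e. r * (U x ^^ t) s0 e) e" by simp
    qed
    also have "\<dots> = real_query E n x (avg x) e"
      unfolding isometry_scale[OF isometry_real_query[OF n E]] using r(2) e
      by (simp add: real_query_def avg_def U_def[abs_def] sum_divide_distrib flip: mult.assoc)
    finally show ?thesis .
  qed
  have ED: "E \<le> D" using T by (simp add: D_def)
  have acc_prob: "(\<Sum>k<E. (fin x k)\<^sup>2) = ip E (avg x) (avg x)" for x
  proof -
    have "(\<Sum>k<E. (fin x k)\<^sup>2) = ip E (real_query E n x (avg x)) (real_query E n x (avg x))"
      using fin_block by (auto simp: ip_def block_def power2_eq_square)
    then show ?thesis using isometry_ip[OF isometry_real_query[OF n E]] by simp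
  qed
  have "(\<Sum>k | k < D \<and> (k < E) = f x. (fin x k)\<^sup>2) \<ge> 2 / 3" for x
  proof (cases "f x")
    case True
    then have "{k. k < D \<and> (k < E) = f x} = {..<E}" using ED by auto
    then show ?thesis using acc_prob acc[OF True] by simp
  next
    case False
    then have "{k. k < D \<and> (k < E) = f x} = {..<D} - {..<E}" by auto
    then have "(\<Sum>k | k < D \<and> (k < E) = f x. (fin x k)\<^sup>2) = ip D (fin x) (fin x) - (\<Sum>k<E. (fin x k)\<^sup>2)"
      using ED by (simp only: sum_diff[of "{..<D}" "{..<E}"] finite_lessThan lessThan_subset_iff)
        (simp add: ip_def power2_eq_square)
    then show ?thesis unfolding fin_norm acc_prob using rej[OF False] by simp
  qed
  then have "computes_with_queries n f (length As)"
    unfolding fin_def using m T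
    by (intro computes_with_real_queries[OF _ D A0(1) isoAs, where out = "\<lambda>k. k < E"]) auto
  then show ?thesis by (simp add: As_def)
qed

lemma
  assumes "isometry D A"
  shows isometry_funpow_ip: "ip D ((A ^^ t) v) ((A ^^ t) w) = ip D v w"
    and isometry_funpow_lincomb: "(A ^^ t) (\<lambda>k. a * v k + b * w k) = (\<lambda>k. a * (A ^^ t) v k + b * (A ^^ t) w k)"
    and isometry_funpow_local: "(\<And>k. k < D \<Longrightarrow> v k = w k) \<Longrightarrow> k < D \<Longrightarrow> (A ^^ t) v k = (A ^^ t) w k"
proof -
  show "ip D ((A ^^ t) v) ((A ^^ t) w) = ip D v w"
    by (induction t) (simp_all add: isometry_ip[OF assms])
  show "(A ^^ t) (\<lambda>k. a * v k + b * w k) = (\<lambda>k. a * (A ^^ t) v k + b * (A ^^ t) w k)"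
    by (induction t) (simp_all add: isometry_lincomb[OF assms])
  show "(A ^^ t) v k = (A ^^ t) w k" if "\<And>k. k < D \<Longrightarrow> v k = w k" "k < D"
    using that(2)
  proof (induction t arbitrary: k)
    case (Suc t)
    then show ?case using isometry_local[OF assms, of "(A ^^ t) v" "(A ^^ t) w"] by simp
  qed (use that in simp)
qed

text \<open>The two halves of the effective spectral gap argument: a long fixed vector that overlaps with
  \<open>s\<close> keeps the averages large, and writing \<open>2 * s = q - A q\<close> makes them telescope.\<close>

lemma average_large:
  assumes A: "isometry D A" and T: "T \<ge> 1"
    and p: "\<And>k. k < D \<Longrightarrow> A p k = p k" "ip D s p = 1" "ip D p p \<le> 3 / 2"
  defines "avg \<equiv> \<lambda>k. (\<Sum>t<T. (A ^^ t) s k) / real T"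
  shows "ip D avg avg \<ge> 2 / 3"
proof -
  have fixed: "k < D \<Longrightarrow> (A ^^ t) p k = p k" for t k
  proof (induction t arbitrary: k)
    case (Suc t)
    have "A ((A ^^ t) p) = A p" by (rule isometry_local[OF A]) (rule Suc.IH)
    then show ?case using p(1)[OF Suc.prems] by simp
  qed simp
  have one: "ip D ((A ^^ t) s) p = 1" for t
  proof -
    have "ip D ((A ^^ t) s) p = ip D ((A ^^ t) s) ((A ^^ t) p)"
      by (rule ip_cong) (auto simp: fixed)
    then show ?thesis using isometry_funpow_ip[OF A] p(2) by simp
  qed
  have "ip D avg p = (\<Sum>t<T. ip D ((A ^^ t) s) p) / real T"
    unfolding ip_def avg_def
    by (subst sum.swap) (simp add: sum_divide_distrib sum_distrib_right)
  also have "\<dots> = 1" using T by (simp add: one)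
  finally have "1 \<le> ip D avg avg * ip D p p" using ip_Cauchy_Schwarz[of D avg p] by simp
  also have "\<dots> \<le> ip D avg avg * (3 / 2)"
    by (intro mult_left_mono p ip_nonneg)
  finally show ?thesis by simp
qed

lemma average_small:
  assumes A: "isometry D A" and T: "T \<ge> 1"
    and q: "\<And>k. k < D \<Longrightarrow> 2 * s k = q k - A q k"
  defines "avg \<equiv> \<lambda>k. (\<Sum>t<T. (A ^^ t) s k) / real T"
  shows "ip D avg avg \<le> ip D q q / (real T)\<^sup>2"
proof -
  have s: "s k = 1/2 * q k + (- 1/2) * A q k" if "k < D" for k
    using q[OF that] by simp
  have iter: "(A ^^ t) s k = 1/2 * ((A ^^ t) q k - (A ^^ Suc t) q k)" if "k < D" for t k
  proof -
    have "(A ^^ t) s k = (A ^^ t) (\<lambda>k. 1/2 * q k + (- 1/2) * A q k) k"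
      by (rule isometry_funpow_local[OF A _ that]) (rule s)
    also have "\<dots> = 1/2 * (A ^^ t) q k + (- 1/2) * (A ^^ t) (A q) k"
      unfolding isometry_funpow_lincomb[OF A] ..
    finally show ?thesis by (simp add: funpow_swap1)
  qed
  \<comment> \<open>Telescoping leaves only the two ends, which have the same norm since iterates of
    an isometry preserve it.\<close>
  have avg: "avg k = 1 / (2 * T) * q k + - (1 / (2 * T) * (A ^^ T) q k)" if "k < D" for k
  proof -
    have "(\<Sum>t<T. (A ^^ t) s k) = 1/2 * (\<Sum>t<T. (A ^^ t) q k - (A ^^ Suc t) q k)"
      unfolding sum_distrib_left by (rule sum.cong) (simp_all only: iter[OF that])
    also have "(\<Sum>t<T. (A ^^ t) q k - (A ^^ Suc t) q k) = q k - (A ^^ T) q k"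
      using sum_lessThan_telescope'[of "\<lambda>t. (A ^^ t) q k" T] by simp
    finally show ?thesis using T by (simp add: avg_def field_simps)
  qed
  have "ip D avg avg \<le> (\<Sum>k<D. 2 * (1 / (2 * T) * q k)\<^sup>2 + 2 * (1 / (2 * T) * (A ^^ T) q k)\<^sup>2)"
    unfolding ip_def
  proof (rule sum_mono)
    fix k assume "k \<in> {..<D}"
    then have k: "k < D" by simp
    have *: "(a + - b)\<^sup>2 \<le> 2 * a\<^sup>2 + 2 * b\<^sup>2" for a b :: real
      using zero_le_power2[of "a + b"] by (simp add: power2_sum power2_diff)
    show "avg k * avg k \<le> 2 * (1 / (2 * T) * q k)\<^sup>2 + 2 * (1 / (2 * T) * (A ^^ T) q k)\<^sup>2"
      using *[of "1 / (2 * T) * q k" "1 / (2 * T) * (A ^^ T) q k"]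
      unfolding avg[OF k] by (simp add: power2_eq_square)
  qed
  also have "\<dots> = (ip D q q + ip D ((A ^^ T) q) ((A ^^ T) q)) / (2 * (real T)\<^sup>2)"
    unfolding ip_def sum.distrib[symmetric] sum_divide_distrib
    by (rule sum.cong) (auto simp: power2_eq_square add_divide_distrib)
  also have "\<dots> = ip D q q / (real T)\<^sup>2"
    unfolding isometry_funpow_ip[OF A] by simp
  finally show ?thesis .
qed

subsection \<open>The query algorithm of a witness\<close>

text \<open>Basis vectors of the step operator: \<open>k\<close> encodes \<open>(j, b, w)\<close>. A vector is put into the
  state \<open>|-\<rangle>\<close> of the query bit \<open>b\<close>, and \<open>odd w\<close> is compared with the queried bit \<open>x j\<close>. With
  \<open>u x j d = 0\<close>, the slots \<open>w div 2 = d\<close> are free for the start state, which has \<open>b\<close> in the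
  state \<open>|+\<rangle>\<close>.\<close>

definition embed ::
  "nat \<Rightarrow> ((nat \<Rightarrow> bool) \<Rightarrow> nat \<Rightarrow> nat \<Rightarrow> real) \<Rightarrow> bool \<Rightarrow> (nat \<Rightarrow> bool) \<Rightarrow> nat \<Rightarrow> real" where
  "embed n u c x k =
    (if (odd (k div (2 * n)) = x (k mod n)) = c
     then (if k div n mod 2 = 0 then 1 else - 1) / sqrt 2 * u x (k mod n) (k div (2 * n) div 2)
     else 0)"

definition start_state :: "nat \<Rightarrow> nat \<Rightarrow> nat \<Rightarrow> real" where
  "start_state n d k = (if k mod n = 0 \<and> k div (2 * n) = 2 * d then 1 / sqrt 2 else 0)"

definition sign_flip :: "nat \<Rightarrow> nat \<Rightarrow> (nat \<Rightarrow> real) \<Rightarrow> nat \<Rightarrow> real" where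
  "sign_flip n D v = (\<lambda>k. if k < D then (if odd (k div (2 * n)) then - v k else v k) else 0)"

lemma isometry_sign_flip: "isometry D (sign_flip n D)"
proof (rule isometryI)
  show "ip D (sign_flip n D v) (sign_flip n D w) = ip D v w" for v w
    unfolding ip_def by (rule sum.cong) (auto simp: sign_flip_def)
qed (auto simp: sign_flip_def)

lemma sum_index_coords:
  fixes f :: "nat \<Rightarrow> nat \<Rightarrow> nat \<Rightarrow> 'a::comm_monoid_add"
  assumes "n \<ge> 1"
  shows "(\<Sum>k<2 * n * m. f (k mod n) (k div n mod 2) (k div (2 * n)))
    = (\<Sum>w<m. \<Sum>j<n. f j 0 w + f j 1 w)"
proof -
  let ?F = "\<lambda>k. f (k mod n) (k div n mod 2) (k div (2 * n))"
  have "(\<Sum>k<2 * n * m. ?F k) = (\<Sum>w<m. \<Sum>e<n * 2. ?F (e + 2 * n * w))"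
    using sum_blocks[of ?F "2 * n" m] by (simp only: mult.commute[of n 2])
  also have "\<dots> = (\<Sum>w<m. \<Sum>b<2. \<Sum>j<n. ?F (j + n * b + 2 * n * w))"
    using sum_blocks[of "\<lambda>e. ?F (e + 2 * n * w)" n 2 for w] by (simp only:)
  also have "\<dots> = (\<Sum>w<m. \<Sum>b<2. \<Sum>j<n. f j b w)"
  proof (intro sum.cong refl)
    fix w b j assume "b \<in> {..<2::nat}" "j \<in> {..<n}"
    then have jb: "j < n" "b < 2" by auto
    have e: "j + n * b + 2 * n * w = j + n * (b + 2 * w)" by (simp add: algebra_simps)
    show "?F (j + n * b + 2 * n * w) = f j b w"
      unfolding e index_coords[OF jb] ..
  qed
  also have "\<dots> = (\<Sum>w<m. \<Sum>j<n. f j 0 w + f j 1 w)"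
    by (simp add: numeral_2_eq_2 sum.distrib)
  finally show ?thesis .
qed

lemma ip_start_state:
  assumes "n \<ge> 1" shows "ip (2 * n * (2 * Suc d)) (start_state n d) (start_state n d) = 1"
proof -
  have "ip (2 * n * (2 * Suc d)) (start_state n d) (start_state n d)
    = (\<Sum>w<2 * Suc d. \<Sum>j<n. (if j = 0 \<and> w = 2 * d then 1 / 2 else 0) + (if j = 0 \<and> w = 2 * d then 1 / 2 else 0))"
    unfolding ip_def start_state_def
    by (subst sum_index_coords[OF assms, symmetric, where f = "\<lambda>j b w. if j = 0 \<and> w = 2 * d then 1 / 2 else 0"])
      (auto intro!: sum.cong)
  also have "\<dots> = (\<Sum>w<2 * Suc d. if w = 2 * d then \<Sum>j<n. if j = 0 then 1 else 0 else 0)"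
    by (intro sum.cong) (auto simp flip: sum_distrib_left)
  also have "\<dots> = 1" using assms by simp
  finally show ?thesis .
qed

text \<open>For fixed \<open>j\<close> and slot \<open>a\<close>, each vector occupies one parity of
  \<open>w\<close>, and the parities agree exactly if \<open>(x j = y j) = (c = c')\<close>; the two
  values of the query bit contribute one half each. Thus \<open>x = y\<close> with equal flags gives
  the squared norm, and opposite flags give the kernel.\<close>

lemma ip_embed:
  assumes n: "n \<ge> 1" and u: "\<And>x j. u x j d = 0"
  shows "ip (2 * n * (2 * Suc d)) (embed n u c x) (embed n u c' y)
    = (\<Sum>j<n. if (x j = y j) = (c = c') then \<Sum>a<d. u x j a * u y j a else 0)"
proof -
  define F where "F j b w = (if (odd w = x j) = c \<and> (odd w = y j) = c'
    then 1 / 2 * (u x j (w div 2) * u y j (w div 2)) else 0)" for j b w :: nat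
  have "ip (2 * n * (2 * Suc d)) (embed n u c x) (embed n u c' y)
      = (\<Sum>k<2 * n * (2 * Suc d). F (k mod n) (k div n mod 2) (k div (2 * n)))"
    unfolding ip_def by (rule sum.cong) (auto simp: embed_def F_def)
  also have "\<dots> = (\<Sum>w<2 * Suc d. \<Sum>j<n. F j 0 w + F j 1 w)"
    by (rule sum_index_coords[OF n])
  also have "\<dots> = (\<Sum>j<n. \<Sum>w<2 * Suc d. F j 0 w + F j 1 w)"
    by (rule sum.swap)
  also have "\<dots> = (\<Sum>j<n. \<Sum>a<Suc d. if (x j = y j) = (c = c') then u x j a * u y j a else 0)"
    unfolding sum_double sum.distrib[symmetric]
    by (intro sum.cong refl) (auto simp: F_def)
  also have "\<dots> = (\<Sum>j<n. if (x j = y j) = (c = c') then \<Sum>a<d. u x j a * u y j a else 0)"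
  proof (rule sum.cong[OF refl])
    have "(\<Sum>a<Suc d. if P then h a else 0) = (if P then \<Sum>a<d. h a else 0)"
      if "h d = 0" for P and h :: "nat \<Rightarrow> real"
      using that by simp
    from this[of "\<lambda>a. u x _ a * u y _ a"]
    show "(\<Sum>a<Suc d. if (x j = y j) = (c = c') then u x j a * u y j a else 0)
      = (if (x j = y j) = (c = c') then \<Sum>a<d. u x j a * u y j a else 0)" for j
      by (simp only: u mult_zero_left)
  qed
  finally show ?thesis .
qed

lemma ip_start_embed:
  assumes "\<And>x j. u x j d = 0"
  shows "ip D (start_state n d) (embed n u c x) = 0"
  unfolding ip_def by (rule sum.neutral) (auto simp: start_state_def embed_def assms)

lemma qop_idx_components:
  assumes "n \<ge> 1"
  shows "qop_idx n x k mod n = k mod n" "qop_idx n x k div (2 * n) = k div (2 * n)"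
    "qop_idx n x k div n mod 2 = (if x (k mod n) then 1 - k div n mod 2 else k div n mod 2)"
proof -
  define j b w where "j = k mod n" and "b = k div n mod 2" and "w = k div (2 * n)"
  have k: "k = j + n * (b + 2 * w)" and jb: "j < n" "b < 2"
    using assms index_eq[of k n] by (auto simp: j_def b_def w_def)
  have b': "(if x j then 1 - b else b) < 2" using jb by auto
  show "qop_idx n x k mod n = k mod n" "qop_idx n x k div (2 * n) = k div (2 * n)"
    "qop_idx n x k div n mod 2 = (if x (k mod n) then 1 - k div n mod 2 else k div n mod 2)"
    unfolding k qop_idx_coords[OF jb] index_coords[OF jb] index_coords[OF jb(1) b'] by auto
qed

lemma real_query_start:
  "n \<ge> 1 \<Longrightarrow> k < D \<Longrightarrow> real_query D n x (start_state n d) k = start_state n d k"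
  by (simp add: real_query_def start_state_def qop_idx_components)

lemma sign_flip_query_start:
  assumes "n \<ge> 1" "k < D"
  shows "sign_flip n D (real_query D n x (start_state n d)) k = start_state n d k"
proof -
  have "odd (k div (2 * n)) \<Longrightarrow> start_state n d k = 0"
    by (auto simp only: start_state_def even_mult_iff even_numeral split: if_splits)
  then show ?thesis using assms by (auto simp: sign_flip_def real_query_start)
qed

text \<open>In the state |-> of the query bit, a query multiplies by -1 if \<open>x j\<close> holds,
  and the flip multiplies by -1 if \<open>w\<close> is odd. The signs cancel exactly where
  \<open>odd w\<close> equals \<open>x j\<close>, which is what the flag \<open>c\<close>
  selects.\<close>

lemma sign_flip_query_embed:
  assumes "n \<ge> 1" "k < D"
  shows "sign_flip n D (real_query D n x (embed n u c x)) k = (if c then 1 else - 1) * embed n u c x k"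
proof -
  have "k div n mod 2 = 0 \<or> k div n mod 2 = 1" by auto
  then show ?thesis
    using assms(2) by (auto simp: sign_flip_def real_query_def embed_def qop_idx_components[OF assms(1)])
qed

lemma real_query_cong:
  assumes "n \<ge> 1" "\<And>i. i < n \<Longrightarrow> x i = y i"
  shows "real_query D n x = real_query D n y"
  using assms by (auto simp: real_query_def qop_idx_def fun_eq_iff)

lemma adv_witness_computes:
  assumes wit: "adv_witness n f W" and n: "n \<ge> 1" and W: "W \<ge> 1"
    and f: "\<And>x y. (\<And>i. i < n \<Longrightarrow> x i = y i) \<Longrightarrow> f x = f y"
  shows "\<exists>T. computes_with_queries n f T \<and> real T \<le> 5 * W"
proof -
  obtain g s where gs: "kernel_rep n g s" "\<And>x. s x \<le> W" "\<And>x y. f x \<Longrightarrow> \<not> f y \<Longrightarrow> g x y = 1"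
    using wit unfolding adv_witness_def by blast
  obtain d :: nat and u where u: "\<And>x j a. a \<ge> d \<Longrightarrow> u x j a = 0"
    "\<And>x. (\<Sum>j<n. \<Sum>a<d. (u x j a)\<^sup>2) = s x"
    "\<And>x y. (\<Sum>j<n. if x j \<noteq> y j then \<Sum>a<d. u x j a * u y j a else 0) = g x y"
    by (rule kernel_repE[OF gs(1)]) blast
  define E where "E = 2 * n * (2 * Suc d)"
  \<comment> \<open>This value keeps the squared norm of \<open>p x\<close> at most 3/2, at the
    price of a squared norm of up to \<open>1 + 2 * W^2\<close> for \<open>q' y\<close>.\<close>
  define \<gamma> where "\<gamma> = 1 / sqrt (2 * W)"
  have \<gamma>: "\<gamma> > 0" "\<gamma>\<^sup>2 = 1 / (2 * W)" "(1 / \<gamma>)\<^sup>2 = 2 * W" using W by (auto simp: \<gamma>_def power_divide)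
  let ?s = "start_state n d"
  have ud: "u x j d = 0" for x j by (rule u) simp
  have ss: "ip E ?s ?s = 1" unfolding E_def by (rule ip_start_state[OF n])
  have se: "ip E ?s (embed n u c x) = 0" "ip E (embed n u c x) ?s = 0" for c x
    using ip_start_embed[where u = u, OF ud] ip_commute by metis+
  have ee: "ip E (embed n u c x) (embed n u c x) = s x" for c x
    unfolding E_def ip_embed[where u = u, OF n ud] u(2)[symmetric] by (simp add: power2_eq_square)
  have eg: "ip E (embed n u True x) (embed n u False y) = g x y" for x y
    unfolding E_def ip_embed[where u = u, OF n ud] u(3)[symmetric] by (intro sum.cong) auto
  \<comment> \<open>If \<open>f x\<close>, the input reflection fixes \<open>p x\<close>, and so
    does \<open>R\<close>, because the inner product with \<open>q y\<close> is
    \<open>1 - g x y = 0\<close>. If \<open>\<not> f y\<close>, the input reflection takes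
    \<open>q' y\<close> to \<open>q y\<close>, which \<open>R\<close> negates, so
    \<open>q' y - U y (q' y) = q' y + q y = 2 * ?s\<close>.\<close>
  define p where "p x = (\<lambda>k. 1 * ?s k + \<gamma> * embed n u True x k)" for x
  define q where "q x = (\<lambda>k. 1 * ?s k + (- (1 / \<gamma>)) * embed n u False x k)" for x
  define q' where "q' x = (\<lambda>k. 1 * ?s k + (1 / \<gamma>) * embed n u False x k)" for x
  have pq: "ip E (p x) (q y) = 0" if "f x" "\<not> f y" for x y
    unfolding p_def q_def ip_lincomb ss se eg gs(3)[OF that] using \<gamma>(1) by simp
  \<comment> \<open>Inputs assign bits to all naturals; one representative for each setting of the
    first \<open>n\<close> bits makes this set finite.\<close>
  define Y where "Y = {y \<in> (\<lambda>B i. i \<in> B) ` Pow {..<n}. \<not> f y}"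
  have "finite Y" by (simp add: Y_def)
  from isometry_negate_span[OF this, of E q] obtain R where R: "isometry E R"
    "\<And>y k. y \<in> Y \<Longrightarrow> k < E \<Longrightarrow> R (q y) k = - q y k"
    "\<And>v k. (\<And>y. y \<in> Y \<Longrightarrow> ip E v (q y) = 0) \<Longrightarrow> k < E \<Longrightarrow> R v k = v k"
    by blast
  define V where "V = (\<lambda>v. R (sign_flip n E v))"
  have V: "isometry E V" unfolding V_def by (rule isometry_comp[OF R(1) isometry_sign_flip])
  have query: "isometry E (real_query E n x)" for x
    by (rule isometry_real_query[OF n E_def])
  define U where "U x = (\<lambda>v. V (real_query E n x v))" for x
  have U: "isometry E (U x)" for x
    unfolding U_def by (rule isometry_comp[OF V query])
  have flip: "sign_flip n E (real_query E n x (\<lambda>k. 1 * ?s k + a * embed n u c x k)) k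
      = ?s k + a * ((if c then 1 else - 1) * embed n u c x k)" if "k < E" for x a c k
    unfolding isometry_lincomb[OF query] isometry_lincomb[OF isometry_sign_flip]
      sign_flip_query_start[OF n that] sign_flip_query_embed[OF n that] by simp
  \<comment> \<open>With \<open>T \<ge> 3 * W\<close>, the bound \<open>3 * W^2 / T^2\<close> for
    rejection is at most 1/3. Rounding up and the extra query give at most \<open>3 * W + 2\<close>,
    which is at most \<open>5 * W\<close> as \<open>W \<ge> 1\<close>.\<close>
  define T where "T = nat \<lceil>3 * W\<rceil>"
  have T: "3 * W \<le> real T" "real T \<le> 3 * W + 1" "T \<ge> 1" using W by (auto simp: T_def, linarith+)
  have "computes_with_queries n f (T + 1)"
  proof (rule computes_with_averaging[OF n _ E_def T(3) V ss])
    show "1 \<le> 2 * Suc d" by simp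
    show "real_query E n x ?s e = ?s e" if "e < E" for x e
      by (rule real_query_start[OF n that])
  next
    fix x assume fx: "f x"
    show "2 / 3 \<le> ip E (\<lambda>e. (\<Sum>t<T. ((\<lambda>v. V (real_query E n x v)) ^^ t) ?s e) / real T)
        (\<lambda>e. (\<Sum>t<T. ((\<lambda>v. V (real_query E n x v)) ^^ t) ?s e) / real T)"
      unfolding U_def[symmetric]
    proof (rule average_large[OF U T(3)])
      show "U x (p x) k = p x k" if "k < E" for k
      proof -
        have U: "U x (p x) = R (p x)"
          unfolding U_def V_def by (rule isometry_local[OF R(1)]) (simp only: p_def flip, simp)
        show ?thesis
          unfolding U using R(3)[OF _ that] pq[OF fx] by (simp add: Y_def)
      qed
      show "ip E ?s (p x) = 1" unfolding p_def ip_lincomb ss se by simp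
      have "ip E (p x) (p x) = 1 + \<gamma>\<^sup>2 * s x"
        unfolding p_def ip_lincomb ss se ee by (simp add: power2_eq_square)
      also have "\<dots> \<le> 1 + \<gamma>\<^sup>2 * W" by (intro add_left_mono mult_left_mono gs) auto
      also have "\<dots> = 3 / 2" using W \<gamma> by simp
      finally show "ip E (p x) (p x) \<le> 3 / 2" .
    qed
  next
    fix x assume fx: "\<not> f x"
    \<comment> \<open>Both \<open>f\<close> and the queries see only the first \<open>n\<close>
      bits, so \<open>x\<close> may be replaced by its representative in \<open>Y\<close>.\<close>
    define y where "y = (\<lambda>i. i \<in> {i. i < n \<and> x i})"
    have xy: "x i = y i" if "i < n" for i using that by (simp add: y_def)
    have "\<not> f y" using f[of x y] xy fx by simp
    then have y: "y \<in> Y" unfolding Y_def y_def by blast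
    have Uxy: "(\<lambda>v. V (real_query E n x v)) = U y"
      unfolding U_def using real_query_cong[OF n xy] by simp
    have step: "2 * ?s k = q' y k - U y (q' y) k" if "k < E" for k
    proof -
      have "U y (q' y) = R (q y)"
        unfolding U_def V_def by (rule isometry_local[OF R(1)]) (simp only: q_def q'_def flip, simp)
      then have "U y (q' y) k = - q y k" using R(2)[OF y that] by simp
      then show ?thesis by (simp add: q_def q'_def)
    qed
    let ?avg = "\<lambda>e. (\<Sum>t<T. (U y ^^ t) ?s e) / real T"
    have "ip E ?avg ?avg \<le> ip E (q' y) (q' y) / (real T)\<^sup>2"
      by (rule average_small[OF U T(3) step])
    also have "ip E (q' y) (q' y) = 1 + (1 / \<gamma>)\<^sup>2 * s y"
      unfolding q'_def ip_lincomb ss se ee by (simp add: power2_eq_square)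
    also have "\<dots> / (real T)\<^sup>2 \<le> (3 * W\<^sup>2) / (9 * W\<^sup>2)"
    proof (rule frac_le)
      have "(1 / \<gamma>)\<^sup>2 * s y \<le> 2 * W * W"
        unfolding \<gamma>(3) using gs(2)[of y] W by (intro mult_left_mono) auto
      moreover have "1 \<le> W\<^sup>2" using W by simp
      ultimately show "1 + (1 / \<gamma>)\<^sup>2 * s y \<le> 3 * W\<^sup>2" by (simp add: power2_eq_square)
      show "9 * W\<^sup>2 \<le> (real T)\<^sup>2" using power_mono[OF T(1), of 2] W by (simp add: power_mult_distrib)
    qed (use W in auto)
    also have "\<dots> = 1 / 3" using W by simp
    finally show "ip E (\<lambda>e. (\<Sum>t<T. ((\<lambda>v. V (real_query E n x v)) ^^ t) ?s e) / real T)
        (\<lambda>e. (\<Sum>t<T. ((\<lambda>v. V (real_query E n x v)) ^^ t) ?s e) / real T) \<le> 1 / 3"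
      unfolding Uxy .
  qed
  then show ?thesis using T(2) W by (intro exI[of _ "T + 1"]) auto
qed

lemma Q_le_adv_witness:
  assumes "adv_witness n f W" "n \<ge> 1" "W \<ge> 1"
    and "\<And>x y. (\<And>i. i < n \<Longrightarrow> x i = y i) \<Longrightarrow> f x = f y"
  shows "real (Q n f) \<le> 5 * W"
proof -
  obtain T where T: "computes_with_queries n f T" "real T \<le> 5 * W"
    using adv_witness_computes[OF assms] by blast
  have "Q n f \<le> T" unfolding Q_def using T(1) by (rule Least_le)
  then show ?thesis using T(2) by linarith
qed

lemma leaves_pos: "wf_formula n \<phi> \<Longrightarrow> n \<ge> 1 \<and> leaves \<phi> \<ge> 1"
proof (induction \<phi>)
  case (AndG fs)
  then obtain g gs where "fs = g # gs" by (cases fs) auto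
  then show ?case using AndG.IH[of g] AndG.prems by auto
next
  case (OrG fs)
  then obtain g gs where "fs = g # gs" by (cases fs) auto
  then show ?case using OrG.IH[of g] OrG.prems by auto
qed auto

theorem theorem2:
  shows "\<exists>C::real. C > 0 \<and>
    (\<forall>n::nat. \<forall>\<phi>::formula. wf_formula n \<phi> \<and> gates \<phi> \<ge> 1 \<longrightarrow>
       real (Q n (\<lambda>x. eval x \<phi>))
         \<le> C * min (real n) (min (sqrt (real (leaves \<phi>)))
                                  (sqrt (real n) * real (gates \<phi>) powr (1/4))))"
proof (intro exI[of _ "20::real"] conjI allI impI)
  fix n \<phi> assume "wf_formula n \<phi> \<and> gates \<phi> \<ge> 1"
  then have wf: "wf_formula n \<phi>" and gates: "gates \<phi> \<ge> 1" by auto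
  have n: "n \<ge> 1" and leaves: "leaves \<phi> \<ge> 1" using leaves_pos[OF wf] by auto
  define f where "f = normalize True \<phi>"
  have eval: "(\<lambda>x. eval x \<phi>) = (\<lambda>x. neval x f)"
    by (simp add: f_def neval_normalize)
  have vars: "nvars f \<subseteq> {..<n}" unfolding f_def by (rule nvars_normalize[OF wf])
  \<comment> \<open>Having a gate rules out a bare literal, whose \<open>live_leaves\<close> would
    be 0.\<close>
  have gate: "\<exists>s gs. f = Gate s gs"
    using gates ngates_normalize[of True \<phi>] by (cases f) (auto simp: f_def)
  have local: "neval x f = neval y f" if "\<And>i. i < n \<Longrightarrow> x i = y i" for x y
    using that vars by (intro neval_cong) auto
  note Q_le = Q_le_adv_witness[OF _ n _ local]
  have powr: "1 \<le> real (gates \<phi>) powr (1/4)" using gates by (simp add: ge_one_powr_ge_zero)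
  have "adv_witness n (\<lambda>x. neval (restrict Map.empty x) f) (real (card (unset n Map.empty)))"
    by (rule adv_witness_decision_tree[where F = "\<lambda>x. neval x f", OF local])
  moreover have "restrict Map.empty x = x" for x by (simp add: restrict_def fun_eq_iff)
  ultimately have "adv_witness n (\<lambda>x. neval x f) (real n)"
    by (simp flip: lessThan_def)
  then have "real (Q n (\<lambda>x. neval x f)) \<le> 5 * real n"
    by (rule Q_le) (use n in auto)
  moreover have "real (Q n (\<lambda>x. neval x f)) \<le> 5 * sqrt (real (leaves \<phi>))"
    by (rule Q_le) (use adv_witness_nleaves[OF vars] leaves in \<open>auto simp: f_def nleaves_normalize\<close>)
  \<comment> \<open>The factor 5 of the simulation and the factor 4 of this witness account for the
    constant 20.\<close>
  moreover have "real (Q n (\<lambda>x. neval x f)) \<le> 5 * (4 * (sqrt (real n) * real (gates \<phi>) powr (1/4)))"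
  proof (rule Q_le)
    show "adv_witness n (\<lambda>x. neval x f) (4 * (sqrt (real n) * real (gates \<phi>) powr (1/4)))"
      using adv_witness_ngates[OF vars gate n] by (simp add: f_def ngates_normalize)
    have "1 * 1 \<le> sqrt (real n) * real (gates \<phi>) powr (1/4)"
      by (rule mult_mono) (use n powr in auto)
    then show "1 \<le> 4 * (sqrt (real n) * real (gates \<phi>) powr (1/4))" by simp
  qed
  ultimately show "real (Q n (\<lambda>x. eval x \<phi>))
      \<le> 20 * min (real n) (min (sqrt (real (leaves \<phi>))) (sqrt (real n) * real (gates \<phi>) powr (1/4)))"
    unfolding eval by (auto simp: min_def)
qed simp

end
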